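(* Let $\mathcal C$ be a connected cogroupoid over a field $k$. Then for any $X,Y\in\mathrm{ob}(\mathcal C)$, the algebra $\mathcal C(X,Y)$ is a $\mathcal C(X,X)$-$\mathcal C(Y,Y)$-bi-Galois object (with left coaction $\Delta_{X,Y}^X$ and right coaction $\Delta_{X,Y}^Y$).
   Context: Algebras are associative unital $k$-algebras, $m$ denotes multiplication. A cocategory $\mathcal C$ consists of a set $\mathrm{ob}(\mathcal C)$; for all $X,Y\in \mathrm{ob}(\mathcal C)$ a $k$-algebra $\mathcal C(X,Y)$; and for all $X,Y,Z$ algebra morphisms $\Delta_{X,Y}^Z:\mathcal C(X,Y)\to\mathcal C(X,Z)\otimes\mathcal C(Z,Y)$ and $\varepsilon_X:\mathcal C(X,X)\to k$ such that $(\Delta_{X,Z}^T\otimes 1)\Delta_{X,Y}^Z=(1\otimes\Delta_{T,Y}^Z)\Delta_{X,Y}^T$ and $(1\otimes\varepsilon_Y)\Delta_{X,Y}^Y=\mathrm{id}=(\varepsilon_X\otimes 1)\Delta_{X,Y}^X$. A cogroupoid is a cocategory together with linear maps $S_{X,Y}:\mathcal C(X,Y)\to\mathcal C(Y,X)$ such that for all $X,Y$ and $a\in\mathcal C(X,X)$: $m(1\otimes S_{Y,X})\Delta_{X,X}^Y(a)=\varepsilon_X(a)1$ in $\mathcal C(X,Y)$ and $m(S_{X,Y}\otimes 1)\Delta_{X,X}^Y(a)=\varepsilon_X(a)1$ in $\mathcal C(Y,X)$. It is connected if $\mathcal C(X,Y)\neq(0)$ for all $X,Y$. Each $\mathcal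 C(X,X)$ is a Hopf algebra with structure maps $\Delta_{X,X}^X,\varepsilon_X,S_{X,X}$. For a Hopf algebra $H$, a left $H$-Galois object is a left $H$-comodule algebra $A\neq(0)$ with coaction $\alpha:A\to H\otimes A$ such that $(1_H\otimes m)(\alpha\otimes 1_A):A\otimes A\to H\otimes A$ is bijective. A right $L$-Galois object is a right $L$-comodule algebra $A\ne(0)$ with coaction $\beta:A\to A\otimes L$ such that $(m\otimes 1_L)(1_A\otimes\beta):A\otimes A\to A\otimes L$ is bijective. An $H$-$L$-bi-Galois object is an $H$-$L$-bicomodule algebra that is both left $H$-Galois and right $L$-Galois. *)

theory Defs
  imports "HOL-Algebra.Module" "HOL-Algebra.AbelCoset"
begin

section \<open>Linear maps and algebras over a field\<close>

definition linear_maps ::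
    "('k, 'm) ring_scheme \<Rightarrow> ('k, 'a, 'n) module_scheme \<Rightarrow> ('k, 'b, 'p) module_scheme \<Rightarrow> ('a \<Rightarrow> 'b) set"
  where "linear_maps K V W =
    {f \<in> carrier V \<rightarrow> carrier W.
       (\<forall>x \<in> carrier V. \<forall>y \<in> carrier V. f (x \<oplus>\<^bsub>V\<^esub> y) = f x \<oplus>\<^bsub>W\<^esub> f y) \<and>
       (\<forall>c \<in> carrier K. \<forall>x \<in> carrier V. f (c \<odot>\<^bsub>V\<^esub> x) = c \<odot>\<^bsub>W\<^esub> f x)}"

text \<open>The library locale \<^locale>\<open>algebra\<close> is restricted to commutative algebras.\<close>

locale k_algebra = K?: field K + A?: ring A + module K A
  for K (structure) and A (structure) +
  assumes smult_mult_left: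
      "\<lbrakk> c \<in> carrier K; x \<in> carrier A; y \<in> carrier A \<rbrakk>
        \<Longrightarrow> (c \<odot>\<^bsub>A\<^esub> x) \<otimes>\<^bsub>A\<^esub> y = c \<odot>\<^bsub>A\<^esub> (x \<otimes>\<^bsub>A\<^esub> y)"
    and smult_mult_right:
      "\<lbrakk> c \<in> carrier K; x \<in> carrier A; y \<in> carrier A \<rbrakk>
        \<Longrightarrow> x \<otimes>\<^bsub>A\<^esub> (c \<odot>\<^bsub>A\<^esub> y) = c \<odot>\<^bsub>A\<^esub> (x \<otimes>\<^bsub>A\<^esub> y)"

definition algebra_maps ::
    "('k, 'm) ring_scheme \<Rightarrow> ('k, 'a, 'n) module_scheme \<Rightarrow> ('k, 'b, 'p) module_scheme \<Rightarrow> ('a \<Rightarrow> 'b) set"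
  where "algebra_maps K A B = linear_maps K A B \<inter> ring_hom A B"

definition scalar_algebra :: "('k, 'm) ring_scheme \<Rightarrow> ('k, 'k) module"
  where "scalar_algebra K =
    \<lparr>carrier = carrier K, mult = mult K, one = one K, zero = zero K, add = add K, smult = mult K\<rparr>"


section \<open>Tensor products\<close>

text \<open>
  The tensor product of \<open>A\<close> and \<open>B\<close> is the free vector space on \<open>carrier A \<times> carrier B\<close> modulo
  the bilinearity relations; its elements are cosets of finitely supported functions. Fields of
  a \<^type>\<open>module\<close> record that play no role for a bare vector space are left \<^const>\<open>undefined\<close>.
\<close>

definition free_space :: "('k, 'm) ring_scheme \<Rightarrow> 's set \<Rightarrow> ('k, 's \<Rightarrow> 'k) module"
  where "free_space K S =
    \<lparr>carrier = {f. (\<forall>s \<in> S. f s \<in> carrier K) \<and> (\<forall>s. s \<notin> S \<longrightarrow> f s = \<zero>\<^bsub>K\<^esub>) \<and>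
                   finite {s. f s \<noteq> \<zero>\<^bsub>K\<^esub>}},
     mult = undefined, one = undefined,
     zero = (\<lambda>_. \<zero>\<^bsub>K\<^esub>), add = (\<lambda>f g s. f s \<oplus>\<^bsub>K\<^esub> g s), smult = (\<lambda>c f s. c \<otimes>\<^bsub>K\<^esub> f s)\<rparr>"

definition basis_vector :: "('k, 'm) ring_scheme \<Rightarrow> 's \<Rightarrow> 's \<Rightarrow> 'k"
  where "basis_vector K s = (\<lambda>t. if t = s then \<one>\<^bsub>K\<^esub> else \<zero>\<^bsub>K\<^esub>)"

definition subspace_generated ::
    "('k, 'm) ring_scheme \<Rightarrow> ('k, 'v, 'n) module_scheme \<Rightarrow> 'v set \<Rightarrow> 'v set"
  where "subspace_generated K V G = \<Inter> {N. submodule N K V \<and> G \<subseteq> N}"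

definition quotient_space ::
    "('k, 'v, 'n) module_scheme \<Rightarrow> 'v set \<Rightarrow> ('k, 'v set) module"
  where "quotient_space V N =
    \<lparr>carrier = a_rcosets\<^bsub>V\<^esub> N, mult = undefined, one = undefined,
     zero = N, add = set_add V, smult = (\<lambda>c T. \<Union>v \<in> T. N +>\<^bsub>V\<^esub> (c \<odot>\<^bsub>V\<^esub> v))\<rparr>"

abbreviation pair_space ::
    "('k, 'm) ring_scheme \<Rightarrow> ('k, 'a, 'n) module_scheme \<Rightarrow> ('k, 'b, 'p) module_scheme
      \<Rightarrow> ('k, 'a \<times> 'b \<Rightarrow> 'k) module"
  where "pair_space K A B \<equiv> free_space K (carrier A \<times> carrier B)"

definition tensor_relations ::
    "('k, 'm) ring_scheme \<Rightarrow> ('k, 'a, 'n) module_scheme \<Rightarrow> ('k, 'b, 'p) module_scheme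
      \<Rightarrow> ('a \<times> 'b \<Rightarrow> 'k) set"
  where "tensor_relations K A B =
    (let F = pair_space K A B; e = basis_vector K in
      {e (a \<oplus>\<^bsub>A\<^esub> a', b) \<ominus>\<^bsub>F\<^esub> (e (a, b) \<oplus>\<^bsub>F\<^esub> e (a', b)) |a a' b.
         a \<in> carrier A \<and> a' \<in> carrier A \<and> b \<in> carrier B} \<union>
      {e (a, b \<oplus>\<^bsub>B\<^esub> b') \<ominus>\<^bsub>F\<^esub> (e (a, b) \<oplus>\<^bsub>F\<^esub> e (a, b')) |a b b'.
         a \<in> carrier A \<and> b \<in> carrier B \<and> b' \<in> carrier B} \<union>
      {e (c \<odot>\<^bsub>A\<^esub> a, b) \<ominus>\<^bsub>F\<^esub> c \<odot>\<^bsub>F\<^esub> e (a, b) |c a b.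
         c \<in> carrier K \<and> a \<in> carrier A \<and> b \<in> carrier B} \<union>
      {e (a, c \<odot>\<^bsub>B\<^esub> b) \<ominus>\<^bsub>F\<^esub> c \<odot>\<^bsub>F\<^esub> e (a, b) |c a b.
         c \<in> carrier K \<and> a \<in> carrier A \<and> b \<in> carrier B})"

type_synonym ('k, 'a, 'b) tensor = "('a \<times> 'b \<Rightarrow> 'k) set"

definition tensor_null ::
    "('k, 'm) ring_scheme \<Rightarrow> ('k, 'a, 'n) module_scheme \<Rightarrow> ('k, 'b, 'p) module_scheme
      \<Rightarrow> ('k, 'a, 'b) tensor"
  where "tensor_null K A B = subspace_generated K (pair_space K A B) (tensor_relations K A B)"

definition tensor_space ::
    "('k, 'm) ring_scheme \<Rightarrow> ('k, 'a, 'n) module_scheme \<Rightarrow> ('k, 'b, 'p) module_scheme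
      \<Rightarrow> ('k, ('k, 'a, 'b) tensor) module"
  where "tensor_space K A B = quotient_space (pair_space K A B) (tensor_null K A B)"

definition pure_tensor ::
    "('k, 'm) ring_scheme \<Rightarrow> ('k, 'a, 'n) module_scheme \<Rightarrow> ('k, 'b, 'p) module_scheme
      \<Rightarrow> 'a \<Rightarrow> 'b \<Rightarrow> ('k, 'a, 'b) tensor"
  where "pure_tensor K A B a b =
    tensor_null K A B +>\<^bsub>pair_space K A B\<^esub> basis_vector K (a, b)"

text \<open>
  The linear map on the tensor product induced by a bilinear map \<open>\<phi>\<close>: evaluate
  \<open>\<Sum> r(a,b) \<phi>(a,b)\<close> on a representative \<open>r\<close>. For bilinear \<open>\<phi>\<close> the value does not depend on
  the representative, so the image below is a singleton.
\<close>

definition tensor_lift ::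
    "('k, 'm) ring_scheme \<Rightarrow> ('k, 'c, 'n) module_scheme \<Rightarrow> ('a \<Rightarrow> 'b \<Rightarrow> 'c)
      \<Rightarrow> ('k, 'a, 'b) tensor \<Rightarrow> 'c"
  where "tensor_lift K M \<phi> t =
    the_elem ((\<lambda>r. \<Oplus>\<^bsub>M\<^esub> p \<in> {p. r p \<noteq> \<zero>\<^bsub>K\<^esub>}. r p \<odot>\<^bsub>M\<^esub> \<phi> (fst p) (snd p)) ` t)"

text \<open>The tensor product algebra, with \<open>(a \<otimes> b)(a' \<otimes> b') = aa' \<otimes> bb'\<close>.\<close>

definition tensor ::
    "('k, 'm) ring_scheme \<Rightarrow> ('k, 'a, 'n) module_scheme \<Rightarrow> ('k, 'b, 'p) module_scheme
      \<Rightarrow> ('k, ('k, 'a, 'b) tensor) module"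
  where "tensor K A B =
    (let T = tensor_space K A B in
      T \<lparr>mult := (\<lambda>t u. tensor_lift K T (\<lambda>a b. tensor_lift K T (\<lambda>a' b'.
                    pure_tensor K A B (a \<otimes>\<^bsub>A\<^esub> a') (b \<otimes>\<^bsub>B\<^esub> b')) u) t),
         one := pure_tensor K A B \<one>\<^bsub>A\<^esub> \<one>\<^bsub>B\<^esub>\<rparr>)"

text \<open>The map \<open>f \<otimes> g\<close> with values in \<open>A \<otimes> B\<close>.\<close>

definition tensor_map ::
    "('k, 'm) ring_scheme \<Rightarrow> ('k, 'a, 'n) module_scheme \<Rightarrow> ('k, 'b, 'p) module_scheme
      \<Rightarrow> ('c \<Rightarrow> 'a) \<Rightarrow> ('d \<Rightarrow> 'b) \<Rightarrow> ('k, 'c, 'd) tensor \<Rightarrow> ('k, 'a, 'b) tensor"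
  where "tensor_map K A B f g =
    tensor_lift K (tensor K A B) (\<lambda>c d. pure_tensor K A B (f c) (g d))"

text \<open>
  The canonical identification \<open>(A \<otimes> B) \<otimes> C \<rightarrow> A \<otimes> (B \<otimes> C)\<close> and its inverse.
\<close>

definition tensor_assoc ::
    "('k, 'm) ring_scheme \<Rightarrow> ('k, 'a, 'n) module_scheme \<Rightarrow> ('k, 'b, 'p) module_scheme
      \<Rightarrow> ('k, 'c, 'q) module_scheme
      \<Rightarrow> ('k, ('k, 'a, 'b) tensor, 'c) tensor \<Rightarrow> ('k, 'a, ('k, 'b, 'c) tensor) tensor"
  where "tensor_assoc K A B C =
    (let T = tensor K A (tensor K B C) in
      tensor_lift K T (\<lambda>t c. tensor_lift K T
        (\<lambda>a b. pure_tensor K A (tensor K B C) a (pure_tensor K B C b c)) t))"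

definition tensor_assoc_inv ::
    "('k, 'm) ring_scheme \<Rightarrow> ('k, 'a, 'n) module_scheme \<Rightarrow> ('k, 'b, 'p) module_scheme
      \<Rightarrow> ('k, 'c, 'q) module_scheme
      \<Rightarrow> ('k, 'a, ('k, 'b, 'c) tensor) tensor \<Rightarrow> ('k, ('k, 'a, 'b) tensor, 'c) tensor"
  where "tensor_assoc_inv K A B C =
    (let T = tensor K (tensor K A B) C in
      tensor_lift K T (\<lambda>a t. tensor_lift K T
        (\<lambda>b c. pure_tensor K (tensor K A B) C (pure_tensor K A B a b) c) t))"

text \<open>The canonical identifications \<open>k \<otimes> A \<rightarrow> A\<close> and \<open>A \<otimes> k \<rightarrow> A\<close>.\<close>

definition tensor_unit_left ::
    "('k, 'm) ring_scheme \<Rightarrow> ('k, 'a, 'n) module_scheme \<Rightarrow> ('k, 'k, 'a) tensor \<Rightarrow> 'a"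
  where "tensor_unit_left K A = tensor_lift K A (\<lambda>c a. c \<odot>\<^bsub>A\<^esub> a)"

definition tensor_unit_right ::
    "('k, 'm) ring_scheme \<Rightarrow> ('k, 'a, 'n) module_scheme \<Rightarrow> ('k, 'a, 'k) tensor \<Rightarrow> 'a"
  where "tensor_unit_right K A = tensor_lift K A (\<lambda>a c. c \<odot>\<^bsub>A\<^esub> a)"

text \<open>Multiplication as a map \<open>A \<otimes> A \<rightarrow> A\<close>.\<close>

definition mult_map ::
    "('k, 'm) ring_scheme \<Rightarrow> ('k, 'a, 'n) module_scheme \<Rightarrow> ('k, 'a, 'a) tensor \<Rightarrow> 'a"
  where "mult_map K A = tensor_lift K A (mult A)"


section \<open>Cocategories and cogroupoids\<close>

text \<open>
  All the algebras \<open>C(X,Y)\<close> are carried by subsets of one type \<^typ>\<open>'a\<close>; this is no restriction,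
  since a set-indexed family of sets embeds into its disjoint union.
  \<open>Delta C X Y Z\<close> is the map \<open>C(X,Y) \<rightarrow> C(X,Z) \<otimes> C(Z,Y)\<close>.
\<close>

record ('o, 'k, 'a) cocategory =
  Ob :: "'o set"
  Alg :: "'o \<Rightarrow> 'o \<Rightarrow> ('k, 'a) module"
  Delta :: "'o \<Rightarrow> 'o \<Rightarrow> 'o \<Rightarrow> 'a \<Rightarrow> ('k, 'a, 'a) tensor"
  Eps :: "'o \<Rightarrow> 'a \<Rightarrow> 'k"

record ('o, 'k, 'a) cogroupoid = "('o, 'k, 'a) cocategory" +
  Ant :: "'o \<Rightarrow> 'o \<Rightarrow> 'a \<Rightarrow> 'a"

locale cocategory = field K for K (structure) and C :: "('o, 'k, 'a, 'z) cocategory_scheme" +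
  assumes Alg_algebra:
      "\<lbrakk> X \<in> Ob C; Y \<in> Ob C \<rbrakk> \<Longrightarrow> k_algebra K (Alg C X Y)"
    and Delta_algebra_map:
      "\<lbrakk> X \<in> Ob C; Y \<in> Ob C; Z \<in> Ob C \<rbrakk>
        \<Longrightarrow> Delta C X Y Z \<in> algebra_maps K (Alg C X Y) (tensor K (Alg C X Z) (Alg C Z Y))"
    and Eps_algebra_map:
      "X \<in> Ob C \<Longrightarrow> Eps C X \<in> algebra_maps K (Alg C X X) (scalar_algebra K)"
    and coassociative:
      "\<lbrakk> X \<in> Ob C; Y \<in> Ob C; Z \<in> Ob C; T \<in> Ob C; a \<in> carrier (Alg C X Y) \<rbrakk>
        \<Longrightarrow> tensor_assoc K (Alg C X T) (Alg C T Z) (Alg C Z Y)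
              (tensor_map K (tensor K (Alg C X T) (Alg C T Z)) (Alg C Z Y)
                (Delta C X Z T) id (Delta C X Y Z a))
          = tensor_map K (Alg C X T) (tensor K (Alg C T Z) (Alg C Z Y))
                id (Delta C T Y Z) (Delta C X Y T a)"
    and counit_right:
      "\<lbrakk> X \<in> Ob C; Y \<in> Ob C; a \<in> carrier (Alg C X Y) \<rbrakk>
        \<Longrightarrow> tensor_unit_right K (Alg C X Y)
              (tensor_map K (Alg C X Y) (scalar_algebra K) id (Eps C Y) (Delta C X Y Y a)) = a"
    and counit_left:
      "\<lbrakk> X \<in> Ob C; Y \<in> Ob C; a \<in> carrier (Alg C X Y) \<rbrakk>
        \<Longrightarrow> tensor_unit_left K (Alg C X Y)
              (tensor_map K (scalar_algebra K) (Alg C X Y) (Eps C X) id (Delta C X Y X a)) = a"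

locale cogroupoid = cocategory K C
  for K (structure) and C :: "('o, 'k, 'a, 'z) cogroupoid_scheme" +
  assumes Ant_linear:
      "\<lbrakk> X \<in> Ob C; Y \<in> Ob C \<rbrakk> \<Longrightarrow> Ant C X Y \<in> linear_maps K (Alg C X Y) (Alg C Y X)"
    and Ant_right:
      "\<lbrakk> X \<in> Ob C; Y \<in> Ob C; a \<in> carrier (Alg C X X) \<rbrakk>
        \<Longrightarrow> mult_map K (Alg C X Y)
              (tensor_map K (Alg C X Y) (Alg C X Y) id (Ant C Y X) (Delta C X X Y a))
          = Eps C X a \<odot>\<^bsub>Alg C X Y\<^esub> \<one>\<^bsub>Alg C X Y\<^esub>"
    and Ant_left:
      "\<lbrakk> X \<in> Ob C; Y \<in> Ob C; a \<in> carrier (Alg C X X) \<rbrakk>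
        \<Longrightarrow> mult_map K (Alg C Y X)
              (tensor_map K (Alg C Y X) (Alg C Y X) (Ant C X Y) id (Delta C X X Y a))
          = Eps C X a \<odot>\<^bsub>Alg C Y X\<^esub> \<one>\<^bsub>Alg C Y X\<^esub>"

locale connected_cogroupoid = cogroupoid +
  assumes connected:
      "\<lbrakk> X \<in> Ob C; Y \<in> Ob C \<rbrakk> \<Longrightarrow> carrier (Alg C X Y) \<noteq> {\<zero>\<^bsub>Alg C X Y\<^esub>}"


section \<open>Hopf algebras and bi-Galois objects\<close>

record ('k, 'h) hopf_algebra = "('k, 'h) module" +
  comult :: "'h \<Rightarrow> ('k, 'h, 'h) tensor"
  counit :: "'h \<Rightarrow> 'k"
  antipode :: "'h \<Rightarrow> 'h"

locale hopf_algebra = k_algebra K H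
  for K (structure) and H :: "('k, 'h, 'z) hopf_algebra_scheme" (structure) +
  assumes comult_algebra_map: "comult H \<in> algebra_maps K H (tensor K H H)"
    and counit_algebra_map: "counit H \<in> algebra_maps K H (scalar_algebra K)"
    and antipode_linear: "antipode H \<in> linear_maps K H H"
    and comult_coassociative:
      "h \<in> carrier H \<Longrightarrow>
        tensor_assoc K H H H (tensor_map K (tensor K H H) H (comult H) id (comult H h))
        = tensor_map K H (tensor K H H) id (comult H) (comult H h)"
    and comult_counit_right:
      "h \<in> carrier H \<Longrightarrow>
        tensor_unit_right K H (tensor_map K H (scalar_algebra K) id (counit H) (comult H h)) = h"
    and comult_counit_left:
      "h \<in> carrier H \<Longrightarrow>
        tensor_unit_left K H (tensor_map K (scalar_algebra K) H (counit H) id (comult H h)) = h"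
    and antipode_right:
      "h \<in> carrier H \<Longrightarrow>
        mult_map K H (tensor_map K H H id (antipode H) (comult H h)) = counit H h \<odot>\<^bsub>H\<^esub> \<one>\<^bsub>H\<^esub>"
    and antipode_left:
      "h \<in> carrier H \<Longrightarrow>
        mult_map K H (tensor_map K H H (antipode H) id (comult H h)) = counit H h \<odot>\<^bsub>H\<^esub> \<one>\<^bsub>H\<^esub>"

definition vertex_hopf_algebra ::
    "('o, 'k, 'a, 'z) cogroupoid_scheme \<Rightarrow> 'o \<Rightarrow> ('k, 'a) hopf_algebra"
  where "vertex_hopf_algebra C X =
    module.extend (Alg C X X)
      (hopf_algebra.fields (Delta C X X X) (Eps C X) (Ant C X X))"

locale left_comodule_algebra =
  fixes K (structure)
    and H :: "('k, 'h, 'y) hopf_algebra_scheme"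
    and A :: "('k, 'a, 'z) module_scheme"
    and \<alpha> :: "'a \<Rightarrow> ('k, 'h, 'a) tensor"
  assumes hopf_left: "hopf_algebra K H"
    and algebra_left: "k_algebra K A"
    and coaction_left_algebra_map: "\<alpha> \<in> algebra_maps K A (tensor K H A)"
    and coaction_left_coassociative:
      "a \<in> carrier A \<Longrightarrow>
        tensor_assoc K H H A (tensor_map K (tensor K H H) A (comult H) id (\<alpha> a))
        = tensor_map K H (tensor K H A) id \<alpha> (\<alpha> a)"
    and coaction_left_counit:
      "a \<in> carrier A \<Longrightarrow>
        tensor_unit_left K A (tensor_map K (scalar_algebra K) A (counit H) id (\<alpha> a)) = a"

locale right_comodule_algebra =
  fixes K (structure)
    and L :: "('k, 'l, 'y) hopf_algebra_scheme"
    and A :: "('k, 'a, 'z) module_scheme"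
    and \<beta> :: "'a \<Rightarrow> ('k, 'a, 'l) tensor"
  assumes hopf_right: "hopf_algebra K L"
    and algebra_right: "k_algebra K A"
    and coaction_right_algebra_map: "\<beta> \<in> algebra_maps K A (tensor K A L)"
    and coaction_right_coassociative:
      "a \<in> carrier A \<Longrightarrow>
        tensor_assoc K A L L (tensor_map K (tensor K A L) L \<beta> id (\<beta> a))
        = tensor_map K A (tensor K L L) id (comult L) (\<beta> a)"
    and coaction_right_counit:
      "a \<in> carrier A \<Longrightarrow>
        tensor_unit_right K A (tensor_map K A (scalar_algebra K) id (counit L) (\<beta> a)) = a"

locale bicomodule_algebra = left_comodule_algebra K H A \<alpha> + right_comodule_algebra K L A \<beta>
  for K (structure)
    and H :: "('k, 'h, 'x) hopf_algebra_scheme"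
    and L :: "('k, 'l, 'y) hopf_algebra_scheme"
    and A :: "('k, 'a, 'z) module_scheme"
    and \<alpha> :: "'a \<Rightarrow> ('k, 'h, 'a) tensor"
    and \<beta> :: "'a \<Rightarrow> ('k, 'a, 'l) tensor" +
  assumes coactions_commute:
      "a \<in> carrier A \<Longrightarrow>
        tensor_assoc K H A L (tensor_map K (tensor K H A) L \<alpha> id (\<beta> a))
        = tensor_map K H (tensor K A L) id \<beta> (\<alpha> a)"

definition left_canonical_map ::
    "('k, 'm) ring_scheme \<Rightarrow> ('k, 'h, 'y) hopf_algebra_scheme \<Rightarrow> ('k, 'a, 'z) module_scheme
      \<Rightarrow> ('a \<Rightarrow> ('k, 'h, 'a) tensor) \<Rightarrow> ('k, 'a, 'a) tensor \<Rightarrow> ('k, 'h, 'a) tensor"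
  where "left_canonical_map K H A \<alpha> =
    tensor_map K H A id (mult_map K A) \<circ> tensor_assoc K H A A \<circ>
    tensor_map K (tensor K H A) A \<alpha> id"

definition right_canonical_map ::
    "('k, 'm) ring_scheme \<Rightarrow> ('k, 'l, 'y) hopf_algebra_scheme \<Rightarrow> ('k, 'a, 'z) module_scheme
      \<Rightarrow> ('a \<Rightarrow> ('k, 'a, 'l) tensor) \<Rightarrow> ('k, 'a, 'a) tensor \<Rightarrow> ('k, 'a, 'l) tensor"
  where "right_canonical_map K L A \<beta> =
    tensor_map K A L (mult_map K A) id \<circ>
    tensor_assoc_inv K A A L \<circ>
    tensor_map K A (tensor K A L) id \<beta>"

locale left_galois_object = left_comodule_algebra +
  assumes left_nonzero: "carrier A \<noteq> {\<zero>\<^bsub>A\<^esub>}"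
    and left_canonical_bij:
      "bij_betw (left_canonical_map K H A \<alpha>) (carrier (tensor K A A)) (carrier (tensor K H A))"

locale right_galois_object = right_comodule_algebra +
  assumes right_nonzero: "carrier A \<noteq> {\<zero>\<^bsub>A\<^esub>}"
    and right_canonical_bij:
      "bij_betw (right_canonical_map K L A \<beta>) (carrier (tensor K A A)) (carrier (tensor K A L))"

locale bi_galois_object =
  bicomodule_algebra K H L A \<alpha> \<beta> + left_galois_object K H A \<alpha> + right_galois_object K L A \<beta>
  for K (structure)
    and H :: "('k, 'h, 'x) hopf_algebra_scheme"
    and L :: "('k, 'l, 'y) hopf_algebra_scheme"
    and A :: "('k, 'a, 'z) module_scheme"
    and \<alpha> :: "'a \<Rightarrow> ('k, 'h, 'a) tensor"
    and \<beta> :: "'a \<Rightarrow> ('k, 'a, 'l) tensor"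

end

theory Submission
  imports Defs
begin

text \<open>
  Write \<open>A = C(X,Y)\<close>, \<open>H = C(X,X)\<close>, \<open>L = C(Y,Y)\<close> and \<open>S\<close> for the antipode
  \<open>C(Y,X) \<rightarrow> C(X,Y)\<close>. The Hopf algebra axioms for \<open>H\<close> and \<open>L\<close>, the comodule
  algebra axioms for both coactions and their compatibility are all instances of the cogroupoid
  axioms at suitable objects, and connectedness gives \<open>A \<noteq> 0\<close>. The content is that the
  canonical maps are bijective, and for this there are explicit inverses:
  \<open>x \<otimes> y \<mapsto> x\<^sub>1 \<otimes> x\<^sub>2 y\<close> is inverted by
  \<open>h \<otimes> y \<mapsto> h\<^sub>1 \<otimes> S(h\<^sub>2) y\<close>, where \<open>h \<in> H\<close> is split through
  \<open>Y\<close>, and \<open>x \<otimes> y \<mapsto> x y\<^sub>1 \<otimes> y\<^sub>2\<close> is inverted by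
  \<open>x \<otimes> l \<mapsto> x S(l\<^sub>1) \<otimes> l\<^sub>2\<close>, where \<open>l \<in> L\<close> is split through
  \<open>X\<close>.

  Each composite is the identity for the same reason. For example, going from \<open>A \<otimes> A\<close> to
  \<open>H \<otimes> A\<close> and back sends \<open>x \<otimes> y\<close> to
  \<open>x\<^sub>1\<^sub>1 \<otimes> S(x\<^sub>1\<^sub>2) x\<^sub>2 y\<close>, where \<open>x\<close> is first split through \<open>X\<close>
  and then its left factor through \<open>Y\<close>. By coassociativity one may instead split \<open>x\<close>
  through \<open>Y\<close> first and then its right factor, an element of \<open>C(Y,Y)\<close>, through
  \<open>X\<close>. Now \<open>S(x\<^sub>2\<^sub>1) x\<^sub>2\<^sub>2 = \<epsilon>(x\<^sub>2) 1\<close> by the antipode axiom, and the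
  counit law leaves \<open>x \<otimes> y\<close>.

  To make such computations rigorous on the concrete tensor product, the universal property is
  established first (\<open>tensor_lift_linear\<close>, \<open>tensor_lift_pure\<close>, \<open>tensor_ext\<close>). A
  Sweedler sum \<open>\<Sum> \<phi>(x\<^sub>1, x\<^sub>2)\<close> is then literally \<open>tensor_lift\<close> of the bilinear
  map \<open>\<phi>\<close> at the coproduct of \<open>x\<close>; coassociativity becomes
  \<open>tensor_lift_Delta_coassociative\<close>, valid under every trilinear map, and the four composites are
  handled by the four lemmas from \<open>cancel_Ant_left_second\<close> to \<open>cancel_Ant_left_first\<close>.
\<close>

section \<open>Linear maps\<close>

lemma linear_mapsI:
  assumes "\<And>x. x \<in> carrier V \<Longrightarrow> f x \<in> carrier W"
    and "\<And>x y. x \<in> carrier V \<Longrightarrow> y \<in> carrier V \<Longrightarrow> f (x \<oplus>\<^bsub>V\<^esub> y) = f x \<oplus>\<^bsub>W\<^esub> f y"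
    and "\<And>c x. c \<in> carrier K \<Longrightarrow> x \<in> carrier V \<Longrightarrow> f (c \<odot>\<^bsub>V\<^esub> x) = c \<odot>\<^bsub>W\<^esub> f x"
  shows "f \<in> linear_maps K V W"
  using assms by (auto simp: linear_maps_def)

lemma linear_mapsD:
  assumes "f \<in> linear_maps K V W"
  shows linear_maps_closed: "\<And>x. x \<in> carrier V \<Longrightarrow> f x \<in> carrier W"
    and linear_maps_add:
      "\<And>x y. x \<in> carrier V \<Longrightarrow> y \<in> carrier V \<Longrightarrow> f (x \<oplus>\<^bsub>V\<^esub> y) = f x \<oplus>\<^bsub>W\<^esub> f y"
    and linear_maps_smult:
      "\<And>c x. c \<in> carrier K \<Longrightarrow> x \<in> carrier V \<Longrightarrow> f (c \<odot>\<^bsub>V\<^esub> x) = c \<odot>\<^bsub>W\<^esub> f x"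
  using assms by (auto simp: linear_maps_def)

lemma linear_map_compose:
  assumes "g \<in> linear_maps K V W" "f \<in> linear_maps K U V"
  shows "(\<lambda>x. g (f x)) \<in> linear_maps K U W"
  using linear_mapsD[OF assms(1)] linear_mapsD[OF assms(2)] by (intro linear_mapsI) auto

lemma linear_map_id: "(\<lambda>x. x) \<in> linear_maps K V V"
  by (intro linear_mapsI) auto

lemma linear_map_cong:
  assumes "f \<in> linear_maps K V W" "module K V" "\<And>x. x \<in> carrier V \<Longrightarrow> f x = g x"
  shows "g \<in> linear_maps K V W"
proof -
  interpret V: module K V by fact
  show ?thesis
    using linear_mapsD[OF assms(1)] assms(3)
    by (intro linear_mapsI) (metis V.M.add.m_closed V.smult_closed)+
qed

lemma linear_map_zero:
  assumes "f \<in> linear_maps K V W" "module K V" "module K W"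
  shows "f \<zero>\<^bsub>V\<^esub> = \<zero>\<^bsub>W\<^esub>"
proof -
  interpret V: module K V by fact
  interpret W: module K W by fact
  have "f (\<zero>\<^bsub>K\<^esub> \<odot>\<^bsub>V\<^esub> \<zero>\<^bsub>V\<^esub>) = \<zero>\<^bsub>K\<^esub> \<odot>\<^bsub>W\<^esub> f \<zero>\<^bsub>V\<^esub>"
    by (rule linear_maps_smult[OF assms(1)]) auto
  then show ?thesis using linear_maps_closed[OF assms(1), of "\<zero>\<^bsub>V\<^esub>"] by simp
qed

lemma linear_map_minus:
  assumes "f \<in> linear_maps K V W" "module K V" "module K W" "x \<in> carrier V" "y \<in> carrier V"
  shows "f (x \<ominus>\<^bsub>V\<^esub> y) = f x \<ominus>\<^bsub>W\<^esub> f y"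
proof -
  interpret V: module K V by fact
  interpret W: module K W by fact
  have "f (x \<ominus>\<^bsub>V\<^esub> y) \<oplus>\<^bsub>W\<^esub> f y = f (x \<ominus>\<^bsub>V\<^esub> y \<oplus>\<^bsub>V\<^esub> y)"
    using assms by (simp add: linear_maps_add[OF assms(1)])
  also have "x \<ominus>\<^bsub>V\<^esub> y \<oplus>\<^bsub>V\<^esub> y = x"
    using assms by (simp add: a_minus_def V.M.a_assoc V.M.l_neg)
  finally show ?thesis
    using assms linear_maps_closed[OF assms(1)]
    by (metis V.M.minus_closed a_minus_def W.M.add.inv_solve_right)
qed

text \<open>
  The uniqueness half of every universal property below: to show that two linear maps agree it is
  enough to put a generating set into their equalizer. Comparison with the zero map gives kernels.
\<close>

lemma equalizer_submodule:
  assumes "f \<in> linear_maps K V W" "g \<in> linear_maps K V W" "module K V" "module K W"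
  shows "submodule {x \<in> carrier V. f x = g x} K V"
proof -
  interpret V: module K V by fact
  interpret W: module K W by fact
  have neg: "h (\<ominus>\<^bsub>V\<^esub> x) = \<ominus>\<^bsub>W\<^esub> h x" if "h \<in> linear_maps K V W" "x \<in> carrier V" for h x
    using linear_maps_smult[OF that(1), of "\<ominus>\<^bsub>K\<^esub> \<one>\<^bsub>K\<^esub>" x] that linear_maps_closed[OF that]
    by (simp add: V.smult_l_minus W.smult_l_minus)
  show ?thesis
    using linear_mapsD[OF assms(1)] linear_mapsD[OF assms(2)]
      linear_map_zero[OF assms(1,3,4)] linear_map_zero[OF assms(2,3,4)] neg[OF assms(1)] neg[OF assms(2)]
    by (intro V.submoduleI) auto
qed


section \<open>Free modules\<close>

lemma free_space_sel [simp]: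
  "zero (free_space K S) = (\<lambda>_. \<zero>\<^bsub>K\<^esub>)"
  "add (free_space K S) = (\<lambda>f g s. f s \<oplus>\<^bsub>K\<^esub> g s)"
  "smult (free_space K S) = (\<lambda>c f s. c \<otimes>\<^bsub>K\<^esub> f s)"
  by (auto simp: free_space_def)

lemma free_space_carrier:
  "f \<in> carrier (free_space K S) \<longleftrightarrow> (\<forall>s \<in> S. f s \<in> carrier K) \<and>
     (\<forall>s. s \<notin> S \<longrightarrow> f s = \<zero>\<^bsub>K\<^esub>) \<and> finite {s. f s \<noteq> \<zero>\<^bsub>K\<^esub>}"
  by (auto simp: free_space_def)

lemma free_space_value:
  assumes "cring K" "f \<in> carrier (free_space K S)" shows "f s \<in> carrier K"
proof -
  interpret cring K by fact
  show ?thesis using assms(2) by (cases "s \<in> S") (auto simp: free_space_carrier)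
qed

lemma free_space_module:
  assumes "cring K" shows "module K (free_space K S)"
proof -
  interpret cring K by fact
  note val = free_space_value[OF assms, of _ S]
  have add_closed: "(\<lambda>s. f s \<oplus>\<^bsub>K\<^esub> g s) \<in> carrier (free_space K S)"
    if "f \<in> carrier (free_space K S)" "g \<in> carrier (free_space K S)" for f g
  proof -
    have "{s. f s \<oplus>\<^bsub>K\<^esub> g s \<noteq> \<zero>\<^bsub>K\<^esub>} \<subseteq> {s. f s \<noteq> \<zero>\<^bsub>K\<^esub>} \<union> {s. g s \<noteq> \<zero>\<^bsub>K\<^esub>}" by auto
    then show ?thesis using that by (auto simp: free_space_carrier intro: finite_subset)
  qed
  have smult_closed: "(\<lambda>s. c \<otimes>\<^bsub>K\<^esub> f s) \<in> carrier (free_space K S)"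
    if "f \<in> carrier (free_space K S)" "c \<in> carrier K" for f c
  proof -
    have "{s. c \<otimes>\<^bsub>K\<^esub> f s \<noteq> \<zero>\<^bsub>K\<^esub>} \<subseteq> {s. f s \<noteq> \<zero>\<^bsub>K\<^esub>}" using that by auto
    then show ?thesis using that by (auto simp: free_space_carrier intro: finite_subset)
  qed
  have neg: "\<exists>g \<in> carrier (free_space K S). (\<lambda>s. g s \<oplus>\<^bsub>K\<^esub> f s) = (\<lambda>_. \<zero>\<^bsub>K\<^esub>)"
    if "f \<in> carrier (free_space K S)" for f
    \<comment> \<open>The additive inverse is \<open>(-1) f\<close>, so its support is controlled by closure under scalars.\<close>
    using smult_closed[OF that, of "\<ominus>\<^bsub>K\<^esub> \<one>\<^bsub>K\<^esub>"] val[OF that]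
    by (intro bexI[where x="\<lambda>s. (\<ominus>\<^bsub>K\<^esub> \<one>\<^bsub>K\<^esub>) \<otimes>\<^bsub>K\<^esub> f s"]) (auto simp: l_minus l_neg)
  have zero: "(\<lambda>_. \<zero>\<^bsub>K\<^esub>) \<in> carrier (free_space K S)"
    by (auto simp: free_space_carrier)
  show ?thesis
  proof (rule moduleI)
    show "abelian_group (free_space K S)"
      by (rule abelian_groupI)
        (use val add_closed neg zero in \<open>auto simp: fun_eq_iff a_assoc a_comm a_lcomm\<close>)
  qed (use assms val smult_closed in \<open>auto simp: fun_eq_iff l_distr r_distr m_assoc\<close>)
qed

lemma basis_vector_carrier:
  assumes "cring K" "s \<in> S" shows "basis_vector K s \<in> carrier (free_space K S)"
proof -
  interpret cring K by fact
  show ?thesis using assms(2)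
    by (auto simp: free_space_carrier basis_vector_def intro: finite_subset[of _ "{s}"])
qed

text \<open>
  Induction on the support: splitting off one point \<open>p\<close> writes \<open>f\<close> as
  \<open>f(p) e\<^sub>p\<close> plus a function with one support point less.
\<close>

lemma free_space_spanned_by_basis:
  assumes K: "cring K" and N: "submodule N K (free_space K S)"
    and basis: "\<And>s. s \<in> S \<Longrightarrow> basis_vector K s \<in> N"
    and f: "f \<in> carrier (free_space K S)"
  shows "f \<in> N"
proof -
  interpret cring K by fact
  interpret F: module K "free_space K S" by (rule free_space_module[OF K])
  note subE = F.submoduleE[OF N]
  have zero: "(\<lambda>_. \<zero>\<^bsub>K\<^esub>) \<in> N"
    using subgroup.one_closed[OF submodule.axioms(1)[OF N]] by simp
  have "\<forall>f. f \<in> carrier (free_space K S) \<longrightarrow> {s. f s \<noteq> \<zero>\<^bsub>K\<^esub>} = A \<longrightarrow> f \<in> N" if "finite A" for A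
    using that
  proof (induction A rule: finite_induct)
    case empty
    then show ?case using zero by (auto simp: fun_eq_iff elim: back_subst[of "\<lambda>x. x \<in> N"])
  next
    case (insert p A)
    show ?case
    proof (intro allI impI)
      fix f assume f: "f \<in> carrier (free_space K S)" and supp: "{s. f s \<noteq> \<zero>\<^bsub>K\<^esub>} = insert p A"
      note val = free_space_value[OF K f]
      let ?g = "f(p := \<zero>\<^bsub>K\<^esub>)"
      have suppg: "{s. ?g s \<noteq> \<zero>\<^bsub>K\<^esub>} = A" using supp insert.hyps by (auto split: if_splits)
      then have "?g \<in> carrier (free_space K S)"
        using f insert.hyps(1) unfolding free_space_carrier by simp
      then have "?g \<in> N" using insert.IH suppg by blast
      moreover have "p \<in> S" using f supp by (auto simp: free_space_carrier)
      then have "(\<lambda>s. f p \<otimes>\<^bsub>K\<^esub> basis_vector K p s) \<in> N"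
        using subE(4)[OF val basis] by simp
      ultimately have "(\<lambda>s. f p \<otimes>\<^bsub>K\<^esub> basis_vector K p s \<oplus>\<^bsub>K\<^esub> ?g s) \<in> N"
        using subE(5) by fastforce
      moreover have "(\<lambda>s. f p \<otimes>\<^bsub>K\<^esub> basis_vector K p s \<oplus>\<^bsub>K\<^esub> ?g s) = f"
        using val by (auto simp: fun_eq_iff basis_vector_def)
      ultimately show "f \<in> N" by simp
    qed
  qed
  then show ?thesis using f by (auto simp: free_space_carrier)
qed

definition free_extension ::
    "('k, 'm) ring_scheme \<Rightarrow> ('k, 'c, 'n) module_scheme \<Rightarrow> ('s \<Rightarrow> 'c) \<Rightarrow> ('s \<Rightarrow> 'k) \<Rightarrow> 'c"
  where "free_extension K M \<phi> r = (\<Oplus>\<^bsub>M\<^esub> p \<in> {p. r p \<noteq> \<zero>\<^bsub>K\<^esub>}. r p \<odot>\<^bsub>M\<^esub> \<phi> p)"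

text \<open>
  The support of a sum of two functions, or of a scalar multiple, may be smaller than the supports of
  the ingredients, so linearity of the extension needs the freedom to sum over a larger set.
\<close>

lemma free_extension_superset:
  assumes "module K M" "\<phi> \<in> S \<rightarrow> carrier M" "f \<in> carrier (free_space K S)"
    "finite A" "{p. f p \<noteq> \<zero>\<^bsub>K\<^esub>} \<subseteq> A" "A \<subseteq> S"
  shows "free_extension K M \<phi> f = (\<Oplus>\<^bsub>M\<^esub> p \<in> A. f p \<odot>\<^bsub>M\<^esub> \<phi> p)"
proof -
  interpret module K M by fact
  note val = free_space_value[OF is_cring assms(3)]
  show ?thesis unfolding free_extension_def
    by (rule M.add.finprod_mono_neutral_cong_left)
      (use assms(2,4,5,6) val in \<open>auto simp: Pi_def subset_iff\<close>)
qed

lemma free_extension_linear: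
  assumes "module K M" "\<phi> \<in> S \<rightarrow> carrier M"
  shows "free_extension K M \<phi> \<in> linear_maps K (free_space K S) M"
proof -
  interpret module K M by fact
  interpret F: module K "free_space K S" by (rule free_space_module[OF is_cring])
  note val = free_space_value[OF is_cring]
  note sup = free_extension_superset[OF assms]
  have phi: "\<phi> p \<in> carrier M" if "p \<in> S" for p using assms(2) that by blast
  have supp: "p \<in> S" if "f \<in> carrier (free_space K S)" "f p \<noteq> \<zero>\<^bsub>K\<^esub>" for f p
    using that by (auto simp: free_space_carrier)
  show ?thesis
  proof (rule linear_mapsI)
    fix f assume f: "f \<in> carrier (free_space K S)"
    then show "free_extension K M \<phi> f \<in> carrier M"
      using assms(2) val[OF f] unfolding free_extension_def free_space_carrier
      by (intro M.finsum_closed) blast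
    fix c assume c: "c \<in> carrier K"
    let ?A = "{p. f p \<noteq> \<zero>\<^bsub>K\<^esub>}"
    have A: "finite ?A" "?A \<subseteq> S" using f by (auto simp: free_space_carrier)
    have cf: "c \<odot>\<^bsub>free_space K S\<^esub> f \<in> carrier (free_space K S)" using c f by (rule F.smult_closed)
    have "free_extension K M \<phi> (c \<odot>\<^bsub>free_space K S\<^esub> f)
        = (\<Oplus>\<^bsub>M\<^esub> p \<in> ?A. (c \<otimes>\<^bsub>K\<^esub> f p) \<odot>\<^bsub>M\<^esub> \<phi> p)"
      using sup[OF cf A(1) _ A(2)] c by fastforce
    also have "\<dots> = (\<Oplus>\<^bsub>M\<^esub> p \<in> ?A. c \<odot>\<^bsub>M\<^esub> (f p \<odot>\<^bsub>M\<^esub> \<phi> p))"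
      using A assms(2) c val[OF f] by (intro M.finsum_cong') (auto intro!: smult_assoc1 smult_closed)
    also have "\<dots> = c \<odot>\<^bsub>M\<^esub> free_extension K M \<phi> f"
      unfolding free_extension_def
      using A assms(2) c val[OF f] by (intro finsum_smult_ldistr[symmetric]) auto
    finally show "free_extension K M \<phi> (c \<odot>\<^bsub>free_space K S\<^esub> f) = c \<odot>\<^bsub>M\<^esub> free_extension K M \<phi> f" .
  next
    fix f g assume f: "f \<in> carrier (free_space K S)" and g: "g \<in> carrier (free_space K S)"
    let ?A = "{p. f p \<noteq> \<zero>\<^bsub>K\<^esub>} \<union> {p. g p \<noteq> \<zero>\<^bsub>K\<^esub>}"
    have A: "finite ?A" "?A \<subseteq> S" using f g by (auto simp: free_space_carrier)
    have fg: "f \<oplus>\<^bsub>free_space K S\<^esub> g \<in> carrier (free_space K S)" using f g by (rule F.a_closed)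
    have "free_extension K M \<phi> (f \<oplus>\<^bsub>free_space K S\<^esub> g)
        = (\<Oplus>\<^bsub>M\<^esub> p \<in> ?A. (f p \<oplus>\<^bsub>K\<^esub> g p) \<odot>\<^bsub>M\<^esub> \<phi> p)"
      using sup[OF fg A(1) _ A(2)] by fastforce
    also have "\<dots> = (\<Oplus>\<^bsub>M\<^esub> p \<in> ?A. f p \<odot>\<^bsub>M\<^esub> \<phi> p \<oplus>\<^bsub>M\<^esub> g p \<odot>\<^bsub>M\<^esub> \<phi> p)"
      using phi supp[OF f] supp[OF g] val[OF f] val[OF g]
      by (intro M.finsum_cong') (auto intro!: smult_l_distr smult_closed M.a_closed)
    also have "\<dots> = (\<Oplus>\<^bsub>M\<^esub> p \<in> ?A. f p \<odot>\<^bsub>M\<^esub> \<phi> p) \<oplus>\<^bsub>M\<^esub> (\<Oplus>\<^bsub>M\<^esub> p \<in> ?A. g p \<odot>\<^bsub>M\<^esub> \<phi> p)"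
      using phi supp[OF f] supp[OF g] val[OF f] val[OF g] by (intro M.finsum_addf) blast+
    also have "\<dots> = free_extension K M \<phi> f \<oplus>\<^bsub>M\<^esub> free_extension K M \<phi> g"
      using sup[OF f A(1) _ A(2)] sup[OF g A(1) _ A(2)] by simp
    finally show "free_extension K M \<phi> (f \<oplus>\<^bsub>free_space K S\<^esub> g)
        = free_extension K M \<phi> f \<oplus>\<^bsub>M\<^esub> free_extension K M \<phi> g" .
  qed
qed

lemma free_extension_basis:
  assumes "module K M" "\<phi> \<in> S \<rightarrow> carrier M" "s \<in> S"
  shows "free_extension K M \<phi> (basis_vector K s) = \<phi> s"
proof -
  interpret module K M by fact
  have "free_extension K M \<phi> (basis_vector K s) = (\<Oplus>\<^bsub>M\<^esub> p \<in> {s}. basis_vector K s p \<odot>\<^bsub>M\<^esub> \<phi> p)"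
    by (rule free_extension_superset[OF assms(1,2) basis_vector_carrier[OF is_cring assms(3)]])
      (use assms(3) in \<open>auto simp: basis_vector_def\<close>)
  also have "\<dots> = \<phi> s"
    using assms(2,3) by (simp add: basis_vector_def Pi_def)
  finally show ?thesis .
qed


section \<open>Quotient modules\<close>

lemma subspace_generated_submodule:
  assumes "module K V" "G \<subseteq> carrier V"
  shows "submodule (subspace_generated K V G) K V"
proof -
  interpret V: module K V by fact
  have ex: "carrier V \<in> {N. submodule N K V \<and> G \<subseteq> N}"
    using V.carrier_is_submodule assms(2) by simp
  show ?thesis unfolding subspace_generated_def
  proof (rule V.submoduleI)
    show "\<Inter> {N. submodule N K V \<and> G \<subseteq> N} \<subseteq> carrier V" using ex by blast
    show "\<zero>\<^bsub>V\<^esub> \<in> \<Inter> {N. submodule N K V \<and> G \<subseteq> N}"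
      using subgroup.one_closed[OF submodule.axioms(1)] by fastforce
  next
    fix a assume "a \<in> \<Inter> {N. submodule N K V \<and> G \<subseteq> N}"
    then show "\<ominus>\<^bsub>V\<^esub> a \<in> \<Inter> {N. submodule N K V \<and> G \<subseteq> N}"
      by (auto dest: V.submoduleE(3))
  next
    fix a b assume "a \<in> \<Inter> {N. submodule N K V \<and> G \<subseteq> N}" "b \<in> \<Inter> {N. submodule N K V \<and> G \<subseteq> N}"
    then show "a \<oplus>\<^bsub>V\<^esub> b \<in> \<Inter> {N. submodule N K V \<and> G \<subseteq> N}"
      by (auto dest: V.submoduleE(5))
  next
    fix c a assume "c \<in> carrier K" "a \<in> \<Inter> {N. submodule N K V \<and> G \<subseteq> N}"
    then show "c \<odot>\<^bsub>V\<^esub> a \<in> \<Inter> {N. submodule N K V \<and> G \<subseteq> N}"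
      by (auto dest: V.submoduleE(4))
  qed
qed

lemma subspace_generated_mem: "x \<in> G \<Longrightarrow> x \<in> subspace_generated K V G"
  by (auto simp: subspace_generated_def)

lemma subspace_generated_least: "submodule N K V \<Longrightarrow> G \<subseteq> N \<Longrightarrow> subspace_generated K V G \<subseteq> N"
  by (auto simp: subspace_generated_def)

lemma submodule_abelian_subgroup:
  assumes "module K V" "submodule N K V" shows "abelian_subgroup N V"
proof -
  interpret V: module K V by fact
  show ?thesis
    by (rule abelian_subgroupI3)
      (use submodule.axioms(1)[OF assms(2)] V.abelian_group_axioms in
        \<open>auto simp: additive_subgroup_def\<close>)
qed

lemma quotient_space_carrier:
  "carrier (quotient_space V N) = (\<lambda>v. N +>\<^bsub>V\<^esub> v) ` carrier V"
  by (auto simp: quotient_space_def A_RCOSETS_def')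

lemma quotient_space_add:
  assumes "module K V" "submodule N K V" "v \<in> carrier V" "w \<in> carrier V"
  shows "(N +>\<^bsub>V\<^esub> v) \<oplus>\<^bsub>quotient_space V N\<^esub> (N +>\<^bsub>V\<^esub> w) = N +>\<^bsub>V\<^esub> (v \<oplus>\<^bsub>V\<^esub> w)"
  using abelian_subgroup.a_rcos_sum[OF submodule_abelian_subgroup[OF assms(1,2)] assms(3,4)]
  by (simp add: quotient_space_def)

text \<open>
  The scalar action on a coset is a union over all its members; each member contributes the same
  coset because \<open>c n \<in> N\<close> for \<open>n \<in> N\<close>.
\<close>

lemma quotient_space_smult:
  assumes "module K V" "submodule N K V" "c \<in> carrier K" "v \<in> carrier V"
  shows "c \<odot>\<^bsub>quotient_space V N\<^esub> (N +>\<^bsub>V\<^esub> v) = N +>\<^bsub>V\<^esub> (c \<odot>\<^bsub>V\<^esub> v)"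
proof -
  interpret V: module K V by fact
  interpret N: abelian_subgroup N V by (rule submodule_abelian_subgroup[OF assms(1,2)])
  have const: "N +>\<^bsub>V\<^esub> (c \<odot>\<^bsub>V\<^esub> u) = N +>\<^bsub>V\<^esub> (c \<odot>\<^bsub>V\<^esub> v)" if u: "u \<in> N +>\<^bsub>V\<^esub> v" for u
  proof -
    obtain n where n: "n \<in> N" "u = n \<oplus>\<^bsub>V\<^esub> v" using u by (auto simp: a_r_coset_def')
    then have "c \<odot>\<^bsub>V\<^esub> u = c \<odot>\<^bsub>V\<^esub> n \<oplus>\<^bsub>V\<^esub> c \<odot>\<^bsub>V\<^esub> v"
      using assms(3,4) by (simp add: V.smult_r_distr)
    moreover have "c \<odot>\<^bsub>V\<^esub> n \<in> N" using V.submoduleE(4)[OF assms(2,3)] n by blast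
    ultimately have "c \<odot>\<^bsub>V\<^esub> u \<in> N +>\<^bsub>V\<^esub> (c \<odot>\<^bsub>V\<^esub> v)" by (auto simp: a_r_coset_def')
    then show ?thesis
      using V.a_repr_independence[OF _ V.smult_closed[OF assms(3,4)] N.a_subgroup] by blast
  qed
  have self: "v \<in> N +>\<^bsub>V\<^esub> v" using N.a_rcos_self assms(4) by blast
  have "(\<Union>u \<in> N +>\<^bsub>V\<^esub> v. N +>\<^bsub>V\<^esub> (c \<odot>\<^bsub>V\<^esub> u)) = N +>\<^bsub>V\<^esub> (c \<odot>\<^bsub>V\<^esub> v)"
    by (rule UN_constant_eq[OF self]) (use const in blast)
  then show ?thesis by (simp add: quotient_space_def)
qed

lemma quotient_space_module:
  assumes "module K V" "submodule N K V"
  shows "module K (quotient_space V N)"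
proof -
  interpret V: module K V by fact
  interpret N: abelian_subgroup N V by (rule submodule_abelian_subgroup[OF assms])
  note add = quotient_space_add[OF assms] and sm = quotient_space_smult[OF assms]
  have zero: "\<zero>\<^bsub>quotient_space V N\<^esub> = N +>\<^bsub>V\<^esub> \<zero>\<^bsub>V\<^esub>"
    using V.a_coset_add_zero[OF N.a_subset] by (simp add: quotient_space_def)
  show ?thesis
  proof (rule moduleI)
    show "abelian_group (quotient_space V N)"
    proof (rule abelian_groupI)
      fix t assume "t \<in> carrier (quotient_space V N)"
      then obtain v where v: "v \<in> carrier V" "t = N +>\<^bsub>V\<^esub> v" by (auto simp: quotient_space_carrier)
      then show "\<exists>u\<in>carrier (quotient_space V N). u \<oplus>\<^bsub>quotient_space V N\<^esub> t = \<zero>\<^bsub>quotient_space V N\<^esub>"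
        by (intro bexI[where x="N +>\<^bsub>V\<^esub> (\<ominus>\<^bsub>V\<^esub> v)"])
          (auto simp: quotient_space_carrier zero add V.M.l_neg)
    qed (auto simp: quotient_space_carrier zero add V.M.a_assoc V.M.a_comm V.M.a_lcomm)
  qed (auto simp: quotient_space_carrier sm add V.is_cring V.smult_l_distr V.smult_r_distr V.smult_assoc1)
qed

section \<open>The universal property of the tensor product\<close>

definition bilinear_maps ::
    "('k, 'm) ring_scheme \<Rightarrow> ('k, 'a, 'n) module_scheme \<Rightarrow> ('k, 'b, 'p) module_scheme
      \<Rightarrow> ('k, 'c, 'q) module_scheme \<Rightarrow> ('a \<Rightarrow> 'b \<Rightarrow> 'c) set"
  where "bilinear_maps K A B M =
    {\<phi>. (\<forall>a \<in> carrier A. (\<lambda>b. \<phi> a b) \<in> linear_maps K B M) \<and>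
        (\<forall>b \<in> carrier B. (\<lambda>a. \<phi> a b) \<in> linear_maps K A M)}"

lemma bilinear_mapsI:
  assumes "\<And>a. a \<in> carrier A \<Longrightarrow> (\<lambda>b. \<phi> a b) \<in> linear_maps K B M"
    and "\<And>b. b \<in> carrier B \<Longrightarrow> (\<lambda>a. \<phi> a b) \<in> linear_maps K A M"
  shows "\<phi> \<in> bilinear_maps K A B M"
  using assms by (auto simp: bilinear_maps_def)

lemma bilinear_mapsD:
  assumes "\<phi> \<in> bilinear_maps K A B M"
  shows bilinear_maps_right: "\<And>a. a \<in> carrier A \<Longrightarrow> (\<lambda>b. \<phi> a b) \<in> linear_maps K B M"
    and bilinear_maps_left: "\<And>b. b \<in> carrier B \<Longrightarrow> (\<lambda>a. \<phi> a b) \<in> linear_maps K A M"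
    and bilinear_maps_closed:
      "\<And>a b. a \<in> carrier A \<Longrightarrow> b \<in> carrier B \<Longrightarrow> \<phi> a b \<in> carrier M"
  using assms by (auto simp: bilinear_maps_def linear_maps_def)

lemma tensor_relations_subset:
  assumes "module K A" "module K B"
  shows "tensor_relations K A B \<subseteq> carrier (pair_space K A B)"
proof -
  interpret A: module K A by fact
  interpret B: module K B by fact
  interpret F: module K "pair_space K A B" by (rule free_space_module[OF A.is_cring])
  have e: "basis_vector K (a, b) \<in> carrier (pair_space K A B)"
    if "a \<in> carrier A" "b \<in> carrier B" for a b
    using that by (intro basis_vector_carrier[OF A.is_cring]) auto
  show ?thesis unfolding tensor_relations_def Let_def
    by (auto simp del: free_space_sel
        intro!: F.M.minus_closed F.M.a_closed F.smult_closed e)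
qed

lemma tensor_null_submodule:
  assumes "module K A" "module K B"
  shows "submodule (tensor_null K A B) K (pair_space K A B)"
  unfolding tensor_null_def
  by (rule subspace_generated_submodule)
    (auto simp: tensor_relations_subset assms intro: free_space_module module.axioms(1)[OF assms(1)])

lemma tensor_sel [simp]:
  "zero (tensor K A B) = zero (tensor_space K A B)"
  "add (tensor K A B) = add (tensor_space K A B)"
  "smult (tensor K A B) = smult (tensor_space K A B)"
  "carrier (tensor K A B) = carrier (tensor_space K A B)"
  by (auto simp: tensor_def Let_def)

lemma linear_maps_tensor_cong:
  "linear_maps K (tensor K A B) M = linear_maps K (tensor_space K A B) M"
  "linear_maps K V (tensor K A B) = linear_maps K V (tensor_space K A B)"
  by (auto simp: linear_maps_def)

text \<open>
  Whether a record is a module depends only on its additive and scalar fields. This carries the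
  module structure from \<open>tensor_space\<close> to \<open>tensor\<close>, and from an algebra to the Hopf
  algebra record that extends it.
\<close>

lemma module_record_cong:
  assumes "module K V"
    "carrier W = carrier V" "add W = add V" "zero W = zero V" "smult W = smult V"
  shows "module K W"
proof -
  interpret module K V by fact
  show ?thesis
    by (intro moduleI abelian_groupI)
      (auto simp: assms is_cring smult_l_distr smult_r_distr smult_assoc1 M.a_assoc
        intro: M.a_comm M.add.l_inv_ex)
qed

lemma tensor_module:
  assumes "module K A" "module K B"
  shows "module K (tensor K A B)"
proof (rule module_record_cong)
  show "module K (tensor_space K A B)"
    unfolding tensor_space_def
    by (intro quotient_space_module tensor_null_submodule assms free_space_module
        module.axioms(1)[OF assms(1)])
qed simp_all

lemma tensor_proj_linear:
  assumes "module K A" "module K B"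
  shows "(\<lambda>f. tensor_null K A B +>\<^bsub>pair_space K A B\<^esub> f)
    \<in> linear_maps K (pair_space K A B) (tensor K A B)"
proof -
  note F = free_space_module[OF module.axioms(1)[OF assms(1)], of "carrier A \<times> carrier B"]
  note N = tensor_null_submodule[OF assms]
  show ?thesis
    unfolding linear_maps_tensor_cong tensor_space_def
    by (rule linear_mapsI)
      (simp_all add: quotient_space_carrier quotient_space_add[OF F N]
        quotient_space_smult[OF F N] del: free_space_sel)
qed

lemma tensor_carrier:
  "carrier (tensor K A B)
    = (\<lambda>f. tensor_null K A B +>\<^bsub>pair_space K A B\<^esub> f) ` carrier (pair_space K A B)"
  by (simp add: tensor_space_def quotient_space_carrier)

text \<open>
  The four families of generators of the null space are exactly the four identities that make
  \<open>a \<otimes> b\<close> additive and homogeneous in each variable.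
\<close>

lemma pure_tensor_bilinear:
  assumes "module K A" "module K B"
  shows "pure_tensor K A B \<in> bilinear_maps K A B (tensor K A B)"
proof -
  interpret A: module K A by fact
  interpret B: module K B by fact
  interpret F: module K "pair_space K A B" by (rule free_space_module[OF A.is_cring])
  interpret N: abelian_subgroup "tensor_null K A B" "pair_space K A B"
    by (rule submodule_abelian_subgroup[OF F.module_axioms tensor_null_submodule[OF assms]])
  let ?F = "pair_space K A B" and ?N = "tensor_null K A B" and ?e = "\<lambda>a b. basis_vector K (a, b)"
  note pi = linear_mapsD[OF tensor_proj_linear[OF assms]]
  have e: "?e a b \<in> carrier ?F" if "a \<in> carrier A" "b \<in> carrier B" for a b
    using that by (intro basis_vector_carrier[OF A.is_cring]) auto
  have eq: "?N +>\<^bsub>?F\<^esub> x = ?N +>\<^bsub>?F\<^esub> y"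
    if "x \<ominus>\<^bsub>?F\<^esub> y \<in> tensor_relations K A B" "x \<in> carrier ?F" "y \<in> carrier ?F" for x y
  proof -
    have "x \<ominus>\<^bsub>?F\<^esub> y \<in> ?N"
      using that(1) unfolding tensor_null_def by (rule subspace_generated_mem)
    then have "x \<in> ?N +>\<^bsub>?F\<^esub> y"
      using N.a_rcos_module_rev[OF that(3,2)] by (simp add: a_minus_def)
    then show ?thesis
      using F.M.a_repr_independence[OF _ that(3) N.a_subgroup] by blast
  qed
  have rel: "?e (a \<oplus>\<^bsub>A\<^esub> a') b \<ominus>\<^bsub>?F\<^esub> (?e a b \<oplus>\<^bsub>?F\<^esub> ?e a' b) \<in> tensor_relations K A B"
      "?e a (b \<oplus>\<^bsub>B\<^esub> b') \<ominus>\<^bsub>?F\<^esub> (?e a b \<oplus>\<^bsub>?F\<^esub> ?e a b') \<in> tensor_relations K A B"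
      "?e (c \<odot>\<^bsub>A\<^esub> a) b \<ominus>\<^bsub>?F\<^esub> c \<odot>\<^bsub>?F\<^esub> ?e a b \<in> tensor_relations K A B"
      "?e a (c \<odot>\<^bsub>B\<^esub> b) \<ominus>\<^bsub>?F\<^esub> c \<odot>\<^bsub>?F\<^esub> ?e a b \<in> tensor_relations K A B"
    if "a \<in> carrier A" "a' \<in> carrier A" "b \<in> carrier B" "b' \<in> carrier B" "c \<in> carrier K"
    for a a' b b' c
    using that unfolding tensor_relations_def Let_def by blast+
  show ?thesis
  proof (intro bilinear_mapsI linear_mapsI)
    fix a b assume a: "a \<in> carrier A" and b: "b \<in> carrier B"
    show closed: "pure_tensor K A B a b \<in> carrier (tensor K A B)"
      "pure_tensor K A B a b \<in> carrier (tensor K A B)"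
      unfolding pure_tensor_def using pi(1)[OF e[OF a b]] by auto
    fix c assume c: "c \<in> carrier K"
    show "pure_tensor K A B (c \<odot>\<^bsub>A\<^esub> a) b = c \<odot>\<^bsub>tensor K A B\<^esub> pure_tensor K A B a b"
      unfolding pure_tensor_def pi(3)[OF c e[OF a b], symmetric]
      using eq[OF rel(3)[OF a a b b c]] e a b c by (simp del: free_space_sel)
    show "pure_tensor K A B a (c \<odot>\<^bsub>B\<^esub> b) = c \<odot>\<^bsub>tensor K A B\<^esub> pure_tensor K A B a b"
      unfolding pure_tensor_def pi(3)[OF c e[OF a b], symmetric]
      using eq[OF rel(4)[OF a a b b c]] e a b c by (simp del: free_space_sel)
  next
    fix a a' b assume a: "a \<in> carrier A" "a' \<in> carrier A" and b: "b \<in> carrier B"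
    show "pure_tensor K A B (a \<oplus>\<^bsub>A\<^esub> a') b
        = pure_tensor K A B a b \<oplus>\<^bsub>tensor K A B\<^esub> pure_tensor K A B a' b"
      unfolding pure_tensor_def pi(2)[OF e[OF a(1) b] e[OF a(2) b], symmetric]
      using eq[OF rel(1)[OF a b b A.R.zero_closed]] e a b by (simp del: free_space_sel)
  next
    fix a b b' assume a: "a \<in> carrier A" and b: "b \<in> carrier B" "b' \<in> carrier B"
    show "pure_tensor K A B a (b \<oplus>\<^bsub>B\<^esub> b')
        = pure_tensor K A B a b \<oplus>\<^bsub>tensor K A B\<^esub> pure_tensor K A B a b'"
      unfolding pure_tensor_def pi(2)[OF e[OF a b(1)] e[OF a b(2)], symmetric]
      using eq[OF rel(2)[OF a a b A.R.zero_closed]] e a b by (simp del: free_space_sel)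
  qed
qed

text \<open>
  For bilinear \<open>\<phi>\<close> the linear extension of \<open>\<phi>\<close> to the free module kills the
  bilinearity relations, hence the submodule they generate, so it is constant on cosets. This is what
  makes the set in the definition of \<open>tensor_lift\<close> a singleton.
\<close>

lemma tensor_lift_coset:
  assumes "module K A" "module K B" "module K M" "\<phi> \<in> bilinear_maps K A B M"
    "f \<in> carrier (pair_space K A B)"
  shows "tensor_lift K M \<phi> (tensor_null K A B +>\<^bsub>pair_space K A B\<^esub> f)
    = free_extension K M (\<lambda>p. \<phi> (fst p) (snd p)) f"
proof -
  interpret A: module K A by fact
  interpret B: module K B by fact
  interpret M: module K M by fact
  interpret F: module K "pair_space K A B" by (rule free_space_module[OF A.is_cring])
  let ?F = "pair_space K A B" and ?N = "tensor_null K A B" and ?e = "\<lambda>a b. basis_vector K (a, b)"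
  let ?E = "free_extension K M (\<lambda>p. \<phi> (fst p) (snd p))"
  interpret N: abelian_subgroup ?N ?F
    by (rule submodule_abelian_subgroup[OF F.module_axioms tensor_null_submodule[OF assms(1,2)]])
  note phi = bilinear_mapsD[OF assms(4)]
  have Pi: "(\<lambda>p. \<phi> (fst p) (snd p)) \<in> carrier A \<times> carrier B \<rightarrow> carrier M"
    using phi(3) by auto
  note lin = free_extension_linear[OF assms(3) Pi]
  note E = linear_mapsD[OF lin] linear_map_minus[OF lin F.module_axioms assms(3)]
  have e: "?e a b \<in> carrier ?F" if "a \<in> carrier A" "b \<in> carrier B" for a b
    using that by (intro basis_vector_carrier[OF A.is_cring]) auto
  have Ee: "?E (?e a b) = \<phi> a b" if "a \<in> carrier A" "b \<in> carrier B" for a b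
    using free_extension_basis[OF assms(3) Pi] that by auto
  have zero: "(\<lambda>_. \<zero>\<^bsub>M\<^esub>) \<in> linear_maps K ?F M"
    by (rule linear_mapsI) auto
  have diff: "?E (x \<ominus>\<^bsub>?F\<^esub> y) = \<zero>\<^bsub>M\<^esub>"
    if "x \<in> carrier ?F" "y \<in> carrier ?F" "?E x = ?E y" for x y
    using that E(1,4) by (simp add: a_minus_def M.M.r_neg del: free_space_sel)
  \<comment> \<open>Each relation is a difference of two elements with the same value under the extension.\<close>
  have "\<forall>n \<in> tensor_relations K A B. ?E n = \<zero>\<^bsub>M\<^esub>"
    unfolding tensor_relations_def Let_def
    using linear_mapsD[OF phi(1)] linear_mapsD[OF phi(2)]
    by (auto simp del: free_space_sel simp: e Ee E(2,3) intro!: diff F.M.a_closed F.smult_closed)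
  then have "tensor_relations K A B \<subseteq> {n \<in> carrier ?F. ?E n = \<zero>\<^bsub>M\<^esub>}"
    using tensor_relations_subset[OF assms(1,2)] by blast
  then have "?N \<subseteq> {n \<in> carrier ?F. ?E n = \<zero>\<^bsub>M\<^esub>}"
    unfolding tensor_null_def
    using equalizer_submodule[OF lin zero F.module_axioms assms(3)]
    by (rule subspace_generated_least[rotated])
  then have "?E r = ?E f" if "r \<in> ?N +>\<^bsub>?F\<^esub> f" for r
    using that assms(5) E(1,2) by (auto simp: a_r_coset_def' subset_iff simp del: free_space_sel)
  moreover have "f \<in> ?N +>\<^bsub>?F\<^esub> f" using N.a_rcos_self assms(5) by blast
  ultimately have "?E ` (?N +>\<^bsub>?F\<^esub> f) = {?E f}" by blast
  then show ?thesis
    unfolding tensor_lift_def free_extension_def by simp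
qed

lemma tensor_lift_linear:
  assumes "module K A" "module K B" "module K M" "\<phi> \<in> bilinear_maps K A B M"
  shows "tensor_lift K M \<phi> \<in> linear_maps K (tensor K A B) M"
proof -
  interpret A: module K A by fact
  interpret F: module K "pair_space K A B" by (rule free_space_module[OF A.is_cring])
  note pi = linear_mapsD[OF tensor_proj_linear[OF assms(1,2)]]
  note L = tensor_lift_coset[OF assms]
  have "(\<lambda>p. \<phi> (fst p) (snd p)) \<in> carrier A \<times> carrier B \<rightarrow> carrier M"
    using bilinear_mapsD(3)[OF assms(4)] by auto
  note E = linear_mapsD[OF free_extension_linear[OF assms(3) this]]
  show ?thesis
  proof (rule linear_mapsI)
    fix t u assume "t \<in> carrier (tensor K A B)" "u \<in> carrier (tensor K A B)"
    then show "tensor_lift K M \<phi> (t \<oplus>\<^bsub>tensor K A B\<^esub> u) = tensor_lift K M \<phi> t \<oplus>\<^bsub>M\<^esub> tensor_lift K M \<phi> u"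
      unfolding tensor_carrier
      by (auto simp: L E pi(2)[symmetric] simp del: free_space_sel tensor_sel)
  next
    fix c t assume "c \<in> carrier K" "t \<in> carrier (tensor K A B)"
    then show "tensor_lift K M \<phi> (c \<odot>\<^bsub>tensor K A B\<^esub> t) = c \<odot>\<^bsub>M\<^esub> tensor_lift K M \<phi> t"
      unfolding tensor_carrier
      by (auto simp: L E pi(3)[symmetric] simp del: free_space_sel tensor_sel)
  next
    fix t assume "t \<in> carrier (tensor K A B)"
    then show "tensor_lift K M \<phi> t \<in> carrier M"
      unfolding tensor_carrier by (auto simp: L E)
  qed
qed

lemma tensor_lift_pure:
  assumes "module K A" "module K B" "module K M" "\<phi> \<in> bilinear_maps K A B M"
    "a \<in> carrier A" "b \<in> carrier B"
  shows "tensor_lift K M \<phi> (pure_tensor K A B a b) = \<phi> a b"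
proof -
  note K = module.axioms(1)[OF assms(1)]
  have ab: "(a, b) \<in> carrier A \<times> carrier B" using assms by auto
  have "(\<lambda>p. \<phi> (fst p) (snd p)) \<in> carrier A \<times> carrier B \<rightarrow> carrier M"
    using bilinear_mapsD(3)[OF assms(4)] by auto
  from free_extension_basis[OF assms(3) this ab] show ?thesis
    unfolding pure_tensor_def tensor_lift_coset[OF assms(1-4) basis_vector_carrier[OF K ab]]
    by simp
qed

text \<open>
  Pure tensors span: pulled back to the free module, the equalizer of the two maps contains every
  basis vector.
\<close>

lemma tensor_ext:
  assumes "module K A" "module K B" "module K M"
    "F \<in> linear_maps K (tensor K A B) M" "G \<in> linear_maps K (tensor K A B) M"
    "\<And>a b. a \<in> carrier A \<Longrightarrow> b \<in> carrier B \<Longrightarrow> F (pure_tensor K A B a b) = G (pure_tensor K A B a b)"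
    "t \<in> carrier (tensor K A B)"
  shows "F t = G t"
proof -
  let ?F = "pair_space K A B" and ?pi = "\<lambda>f. tensor_null K A B +>\<^bsub>pair_space K A B\<^esub> f"
  note K = module.axioms(1)[OF assms(1)]
  note pi = tensor_proj_linear[OF assms(1,2)]
  obtain f where f: "f \<in> carrier ?F" "t = ?pi f"
    using assms(7) unfolding tensor_carrier by auto
  have "f \<in> {x \<in> carrier ?F. F (?pi x) = G (?pi x)}"
  proof (rule free_space_spanned_by_basis[OF K _ _ f(1)])
    show "submodule {x \<in> carrier ?F. F (?pi x) = G (?pi x)} K ?F"
      by (rule equalizer_submodule[OF linear_map_compose[OF assms(4) pi]
            linear_map_compose[OF assms(5) pi] free_space_module[OF K] assms(3)])
    show "basis_vector K s \<in> {x \<in> carrier ?F. F (?pi x) = G (?pi x)}"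
      if "s \<in> carrier A \<times> carrier B" for s
      using that assms(6) basis_vector_carrier[OF K that]
      by (auto simp: pure_tensor_def[symmetric])
  qed
  then show ?thesis using f(2) by simp
qed

section \<open>Computing with induced maps\<close>

lemma linear_map_add:
  assumes "module K V" "module K W" "f \<in> linear_maps K V W" "g \<in> linear_maps K V W"
  shows "(\<lambda>x. f x \<oplus>\<^bsub>W\<^esub> g x) \<in> linear_maps K V W"
proof -
  interpret W: module K W by fact
  show ?thesis
    using linear_mapsD[OF assms(3)] linear_mapsD[OF assms(4)]
    by (intro linear_mapsI) (simp_all add: W.smult_r_distr W.M.a_ac)
qed

lemma linear_map_smult:
  assumes "module K W" "f \<in> linear_maps K V W" "c \<in> carrier K"
  shows "(\<lambda>x. c \<odot>\<^bsub>W\<^esub> f x) \<in> linear_maps K V W"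
proof -
  interpret W: module K W by fact
  show ?thesis
    using linear_mapsD[OF assms(2)] assms(3)
    by (intro linear_mapsI)
      (simp_all add: W.smult_r_distr W.smult_assoc1[symmetric] W.R.m_comm)
qed

lemma bilinear_map_compose:
  assumes "\<phi> \<in> bilinear_maps K A B M" "f \<in> linear_maps K U A" "g \<in> linear_maps K V B"
  shows "(\<lambda>u v. \<phi> (f u) (g v)) \<in> bilinear_maps K U V M"
proof (rule bilinear_mapsI)
  fix u assume "u \<in> carrier U"
  then show "(\<lambda>v. \<phi> (f u) (g v)) \<in> linear_maps K V M"
    by (intro linear_map_compose[OF bilinear_maps_right[OF assms(1)] assms(3)]
        linear_maps_closed[OF assms(2)])
next
  fix v assume "v \<in> carrier V"
  then show "(\<lambda>u. \<phi> (f u) (g v)) \<in> linear_maps K U M"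
    by (intro linear_map_compose[OF bilinear_maps_left[OF assms(1)] assms(2)]
        linear_maps_closed[OF assms(3)])
qed

lemma linear_bilinear_compose:
  assumes "g \<in> linear_maps K M N" "\<phi> \<in> bilinear_maps K A B M"
  shows "(\<lambda>a b. g (\<phi> a b)) \<in> bilinear_maps K A B N"
  using bilinear_mapsD[OF assms(2)]
  by (intro bilinear_mapsI linear_map_compose[OF assms(1)]) auto

lemma bilinear_map_cong:
  assumes "module K A" "module K B" "\<phi> \<in> bilinear_maps K A B M"
    "\<And>a b. a \<in> carrier A \<Longrightarrow> b \<in> carrier B \<Longrightarrow> \<phi> a b = \<psi> a b"
  shows "\<psi> \<in> bilinear_maps K A B M"
  using linear_map_cong[OF bilinear_maps_right[OF assms(3)] assms(2)]
    linear_map_cong[OF bilinear_maps_left[OF assms(3)] assms(1)] assms(4)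
  by (intro bilinear_mapsI) auto

lemma tensor_lift_closed:
  assumes "module K A" "module K B" "module K M" "\<phi> \<in> bilinear_maps K A B M"
    "t \<in> carrier (tensor K A B)"
  shows "tensor_lift K M \<phi> t \<in> carrier M"
  by (rule linear_maps_closed[OF tensor_lift_linear[OF assms(1-4)] assms(5)])

lemma tensor_lift_cong:
  assumes "module K A" "module K B" "module K M" "\<phi> \<in> bilinear_maps K A B M"
    "t \<in> carrier (tensor K A B)"
    "\<And>a b. a \<in> carrier A \<Longrightarrow> b \<in> carrier B \<Longrightarrow> \<phi> a b = \<psi> a b"
  shows "tensor_lift K M \<phi> t = tensor_lift K M \<psi> t"
proof -
  note psi = bilinear_map_cong[OF assms(1,2,4,6)]
  show ?thesis
    by (rule tensor_ext[OF assms(1-3) tensor_lift_linear[OF assms(1-4)]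
          tensor_lift_linear[OF assms(1-3) psi] _ assms(5)])
      (simp_all add: tensor_lift_pure[OF assms(1-4)] tensor_lift_pure[OF assms(1-3) psi] assms(6))
qed

text \<open>
  From here on \<open>tensor_lift K M \<phi> t\<close> plays the role of the Sweedler sum
  \<open>\<Sum> \<phi>(t\<^sub>1, t\<^sub>2)\<close>. This lemma and \<open>tensor_lift_cong\<close> are the
  rules of that notation: a linear map may be moved under the sum, and a summand may be rewritten
  for elements of the two factors.
\<close>

lemma linear_tensor_lift:
  assumes "module K A" "module K B" "module K M" "module K N" "\<phi> \<in> bilinear_maps K A B M"
    "g \<in> linear_maps K M N" "t \<in> carrier (tensor K A B)"
  shows "g (tensor_lift K M \<phi> t) = tensor_lift K N (\<lambda>a b. g (\<phi> a b)) t"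
proof -
  note psi = linear_bilinear_compose[OF assms(6,5)]
  show ?thesis
    by (rule tensor_ext[OF assms(1,2,4)
          linear_map_compose[OF assms(6) tensor_lift_linear[OF assms(1-3,5)]]
          tensor_lift_linear[OF assms(1,2,4) psi] _ assms(7)])
      (simp add: tensor_lift_pure[OF assms(1-3,5)] tensor_lift_pure[OF assms(1,2,4) psi])
qed

text \<open>
  Needed because Sweedler sums are nested: the inner sum must itself be linear in the variables bound
  outside. For fixed parameters both sides of the required identity are linear in \<open>t\<close>, so it
  suffices to compare them on pure tensors, where the hypothesis applies.
\<close>

lemma tensor_lift_linear_in_parameter:
  assumes "module K A" "module K B" "module K M" "module K V"
    "\<And>z. z \<in> carrier V \<Longrightarrow> \<phi> z \<in> bilinear_maps K A B M"
    "\<And>a b. a \<in> carrier A \<Longrightarrow> b \<in> carrier B \<Longrightarrow> (\<lambda>z. \<phi> z a b) \<in> linear_maps K V M"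
    "t \<in> carrier (tensor K A B)"
  shows "(\<lambda>z. tensor_lift K M (\<phi> z) t) \<in> linear_maps K V M"
proof -
  interpret V: module K V by fact
  interpret T: module K "tensor K A B" by (rule tensor_module[OF assms(1,2)])
  note lin = tensor_lift_linear[OF assms(1-3,5)]
  note pure = tensor_lift_pure[OF assms(1-3,5)]
  show ?thesis
  proof (rule linear_mapsI)
    fix z assume z: "z \<in> carrier V"
    then show "tensor_lift K M (\<phi> z) t \<in> carrier M"
      by (intro tensor_lift_closed[OF assms(1-3) _ assms(7)] assms(5))
    fix c assume c: "c \<in> carrier K"
    have cz: "c \<odot>\<^bsub>V\<^esub> z \<in> carrier V" using c z by simp
    show "tensor_lift K M (\<phi> (c \<odot>\<^bsub>V\<^esub> z)) t = c \<odot>\<^bsub>M\<^esub> tensor_lift K M (\<phi> z) t"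
      by (rule tensor_ext[OF assms(1-3) lin[OF cz] linear_map_smult[OF assms(3) lin[OF z] c] _ assms(7)])
        (simp add: pure[OF cz] pure[OF z] linear_maps_smult[OF assms(6)] c z)
  next
    fix z z' assume z: "z \<in> carrier V" "z' \<in> carrier V"
    have zz: "z \<oplus>\<^bsub>V\<^esub> z' \<in> carrier V" using z by simp
    show "tensor_lift K M (\<phi> (z \<oplus>\<^bsub>V\<^esub> z')) t = tensor_lift K M (\<phi> z) t \<oplus>\<^bsub>M\<^esub> tensor_lift K M (\<phi> z') t"
      by (rule tensor_ext[OF assms(1-3) lin[OF zz]
            linear_map_add[OF T.module_axioms assms(3) lin[OF z(1)] lin[OF z(2)]] _ assms(7)])
        (simp add: pure[OF zz] pure[OF z(1)] pure[OF z(2)] linear_maps_add[OF assms(6)] z)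
  qed
qed

lemma tensor_map_bilinear:
  assumes "module K A" "module K B" "f \<in> linear_maps K U A" "g \<in> linear_maps K V B"
  shows "(\<lambda>u v. pure_tensor K A B (f u) (g v)) \<in> bilinear_maps K U V (tensor K A B)"
  by (rule bilinear_map_compose[OF pure_tensor_bilinear[OF assms(1,2)] assms(3,4)])

lemma tensor_map_linear:
  assumes "module K A" "module K B" "module K U" "module K V"
    "f \<in> linear_maps K U A" "g \<in> linear_maps K V B"
  shows "tensor_map K A B f g \<in> linear_maps K (tensor K U V) (tensor K A B)"
  unfolding tensor_map_def
  by (rule tensor_lift_linear[OF assms(3,4) tensor_module[OF assms(1,2)]
        tensor_map_bilinear[OF assms(1,2,5,6)]])

lemma tensor_map_pure:
  assumes "module K A" "module K B" "module K U" "module K V"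
    "f \<in> linear_maps K U A" "g \<in> linear_maps K V B" "u \<in> carrier U" "v \<in> carrier V"
  shows "tensor_map K A B f g (pure_tensor K U V u v) = pure_tensor K A B (f u) (g v)"
  unfolding tensor_map_def
  by (rule tensor_lift_pure[OF assms(3,4) tensor_module[OF assms(1,2)]
        tensor_map_bilinear[OF assms(1,2,5,6)] assms(7,8)])

text \<open>
  The axioms are stated with \<open>f \<otimes> g\<close> applied to a coproduct; this rule turns them into Sweedler
  sums.
\<close>

lemma tensor_lift_tensor_map:
  assumes "module K A" "module K B" "module K U" "module K V" "module K M"
    "f \<in> linear_maps K U A" "g \<in> linear_maps K V B" "\<phi> \<in> bilinear_maps K A B M"
    "t \<in> carrier (tensor K U V)"
  shows "tensor_lift K M \<phi> (tensor_map K A B f g t) = tensor_lift K M (\<lambda>u v. \<phi> (f u) (g v)) t"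
proof -
  note psi = bilinear_map_compose[OF assms(8,6,7)]
  show ?thesis
    by (rule tensor_ext[OF assms(3-5)
          linear_map_compose[OF tensor_lift_linear[OF assms(1,2,5,8)] tensor_map_linear[OF assms(1-4,6,7)]]
          tensor_lift_linear[OF assms(3-5) psi] _ assms(9)])
      (simp add: tensor_map_pure[OF assms(1-4,6,7)] tensor_lift_pure[OF assms(1,2,5,8)]
        tensor_lift_pure[OF assms(3-5) psi] linear_maps_closed[OF assms(6)] linear_maps_closed[OF assms(7)])
qed

text \<open>
  Trilinearity is phrased through two overlapping bilinearity conditions, because these are the forms
  in which it is used: summing over the last two variables or over the first two.
\<close>

definition trilinear_maps ::
    "('k, 'm) ring_scheme \<Rightarrow> ('k, 'a, 'n) module_scheme \<Rightarrow> ('k, 'b, 'p) module_scheme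
      \<Rightarrow> ('k, 'c, 'q) module_scheme \<Rightarrow> ('k, 'd, 'r) module_scheme \<Rightarrow> ('a \<Rightarrow> 'b \<Rightarrow> 'c \<Rightarrow> 'd) set"
  where "trilinear_maps K A B C M =
    {f. (\<forall>a \<in> carrier A. (\<lambda>b c. f a b c) \<in> bilinear_maps K B C M) \<and>
        (\<forall>c \<in> carrier C. (\<lambda>a b. f a b c) \<in> bilinear_maps K A B M)}"

lemma trilinear_mapsD:
  assumes "f \<in> trilinear_maps K A B C M"
  shows "\<And>a. a \<in> carrier A \<Longrightarrow> (\<lambda>b c. f a b c) \<in> bilinear_maps K B C M"
    and "\<And>c. c \<in> carrier C \<Longrightarrow> (\<lambda>a b. f a b c) \<in> bilinear_maps K A B M"
  using assms by (auto simp: trilinear_maps_def)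

lemma tensor_lift_trilinear_right:
  assumes "module K A" "module K B" "module K C" "module K M" "f \<in> trilinear_maps K A B C M"
  shows "(\<lambda>a u. tensor_lift K M (f a) u) \<in> bilinear_maps K A (tensor K B C) M"
  by (intro bilinear_mapsI tensor_lift_linear[OF assms(2-4)] trilinear_mapsD(1)[OF assms(5)]
      tensor_lift_linear_in_parameter[OF assms(2-4,1)]
      bilinear_maps_left[OF trilinear_mapsD(2)[OF assms(5)]])

lemma tensor_lift_trilinear_left:
  assumes "module K A" "module K B" "module K C" "module K M" "f \<in> trilinear_maps K A B C M"
  shows "(\<lambda>t c. tensor_lift K M (\<lambda>a b. f a b c) t) \<in> bilinear_maps K (tensor K A B) C M"
  by (intro bilinear_mapsI tensor_lift_linear[OF assms(1,2,4)] trilinear_mapsD(2)[OF assms(5)]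
      tensor_lift_linear_in_parameter[OF assms(1,2,4,3)]
      bilinear_maps_right[OF trilinear_mapsD(1)[OF assms(5)]])

text \<open>
  The trilinear maps that occur below are all built from a bilinear map by substituting a bilinear
  expression into one of its arguments.
\<close>

lemma nested_bilinear_trilinear:
  assumes "G \<in> bilinear_maps K A V M" "m \<in> bilinear_maps K B C V"
  shows "(\<lambda>a b c. G a (m b c)) \<in> trilinear_maps K A B C M"
  unfolding trilinear_maps_def
  using linear_bilinear_compose[OF bilinear_maps_right[OF assms(1)] assms(2)]
    bilinear_map_compose[OF assms(1) linear_map_id bilinear_maps_left[OF assms(2)]] by blast

lemma nested_bilinear_trilinear':
  assumes "G \<in> bilinear_maps K V C M" "m \<in> bilinear_maps K A B V"
  shows "(\<lambda>a b c. G (m a b) c) \<in> trilinear_maps K A B C M"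
  unfolding trilinear_maps_def
  using linear_bilinear_compose[OF bilinear_maps_left[OF assms(1)] assms(2)]
    bilinear_map_compose[OF assms(1) bilinear_maps_right[OF assms(2)] linear_map_id] by blast

lemma pure_pure_trilinear:
  assumes "module K A" "module K B" "module K C"
  shows "(\<lambda>a b c. pure_tensor K A (tensor K B C) a (pure_tensor K B C b c))
      \<in> trilinear_maps K A B C (tensor K A (tensor K B C))"
    and "(\<lambda>a b c. pure_tensor K (tensor K A B) C (pure_tensor K A B a b) c)
      \<in> trilinear_maps K A B C (tensor K (tensor K A B) C)"
  by (rule nested_bilinear_trilinear[OF pure_tensor_bilinear pure_tensor_bilinear]
      nested_bilinear_trilinear'[OF pure_tensor_bilinear pure_tensor_bilinear];
      intro tensor_module assms)+

lemma tensor_assoc_linear: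
  assumes "module K A" "module K B" "module K C"
  shows "tensor_assoc K A B C
    \<in> linear_maps K (tensor K (tensor K A B) C) (tensor K A (tensor K B C))"
  unfolding tensor_assoc_def Let_def
  by (intro tensor_lift_linear tensor_lift_trilinear_left pure_pure_trilinear tensor_module assms)

lemma tensor_assoc_pure:
  assumes "module K A" "module K B" "module K C" "t \<in> carrier (tensor K A B)" "c \<in> carrier C"
  shows "tensor_assoc K A B C (pure_tensor K (tensor K A B) C t c)
    = tensor_lift K (tensor K A (tensor K B C))
        (\<lambda>a b. pure_tensor K A (tensor K B C) a (pure_tensor K B C b c)) t"
  unfolding tensor_assoc_def Let_def
  by (intro tensor_lift_pure tensor_lift_trilinear_left pure_pure_trilinear tensor_module assms)

lemma tensor_assoc_inv_linear:
  assumes "module K A" "module K B" "module K C"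
  shows "tensor_assoc_inv K A B C
    \<in> linear_maps K (tensor K A (tensor K B C)) (tensor K (tensor K A B) C)"
  unfolding tensor_assoc_inv_def Let_def
  by (intro tensor_lift_linear tensor_lift_trilinear_right pure_pure_trilinear tensor_module assms)

lemma tensor_assoc_inv_pure:
  assumes "module K A" "module K B" "module K C" "a \<in> carrier A" "u \<in> carrier (tensor K B C)"
  shows "tensor_assoc_inv K A B C (pure_tensor K A (tensor K B C) a u)
    = tensor_lift K (tensor K (tensor K A B) C)
        (\<lambda>b c. pure_tensor K (tensor K A B) C (pure_tensor K A B a b) c) u"
  unfolding tensor_assoc_inv_def Let_def
  by (intro tensor_lift_pure tensor_lift_trilinear_right pure_pure_trilinear tensor_module assms)

text \<open>
  Rebracketing does not change a trilinear sum. Only the first factor of a pure tensor in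
  \<open>(A \<otimes> B) \<otimes> C\<close> needs to be expanded further, since \<open>tensor_assoc\<close> is itself defined by
  a sum over it.
\<close>

lemma tensor_lift_tensor_assoc:
  assumes "module K A" "module K B" "module K C" "module K M" "f \<in> trilinear_maps K A B C M"
    "w \<in> carrier (tensor K (tensor K A B) C)"
  shows "tensor_lift K M (\<lambda>a u. tensor_lift K M (f a) u) (tensor_assoc K A B C w)
    = tensor_lift K M (\<lambda>t c. tensor_lift K M (\<lambda>a b. f a b c) t) w"
proof (rule tensor_ext[where t=w])
  let ?T = "tensor K A (tensor K B C)"
  note AB = tensor_module[OF assms(1,2)] and BC = tensor_module[OF assms(2,3)]
  note T = tensor_module[OF assms(1) BC]
  note R = tensor_lift_trilinear_right[OF assms(1-5)] and L = tensor_lift_trilinear_left[OF assms(1-5)]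
  show "module K (tensor K A B)" "module K C" "module K M" by fact+
  show "(\<lambda>w. tensor_lift K M (\<lambda>a u. tensor_lift K M (f a) u) (tensor_assoc K A B C w))
      \<in> linear_maps K (tensor K (tensor K A B) C) M"
    by (rule linear_map_compose[OF tensor_lift_linear[OF assms(1) BC assms(4) R]
          tensor_assoc_linear[OF assms(1-3)]])
  show "(\<lambda>w. tensor_lift K M (\<lambda>t c. tensor_lift K M (\<lambda>a b. f a b c) t) w)
      \<in> linear_maps K (tensor K (tensor K A B) C) M"
    by (rule tensor_lift_linear[OF AB assms(3,4) L])
  fix t c assume t: "t \<in> carrier (tensor K A B)" and c: "c \<in> carrier C"
  note P = trilinear_mapsD(2)[OF pure_pure_trilinear(1)[OF assms(1-3)] c]
  have "tensor_lift K M (\<lambda>a u. tensor_lift K M (f a) u)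
      (tensor_assoc K A B C (pure_tensor K (tensor K A B) C t c))
      = tensor_lift K M (\<lambda>a b. tensor_lift K M (\<lambda>a u. tensor_lift K M (f a) u)
          (pure_tensor K A (tensor K B C) a (pure_tensor K B C b c))) t"
    unfolding tensor_assoc_pure[OF assms(1-3) t c]
    by (rule linear_tensor_lift[OF assms(1,2) T assms(4) P
          tensor_lift_linear[OF assms(1) BC assms(4) R] t])
  also have "\<dots> = tensor_lift K M (\<lambda>a b. f a b c) t"
  proof (rule tensor_lift_cong[OF assms(1,2,4) _ t])
    show "(\<lambda>a b. tensor_lift K M (\<lambda>a u. tensor_lift K M (f a) u)
        (pure_tensor K A (tensor K B C) a (pure_tensor K B C b c))) \<in> bilinear_maps K A B M"
      by (rule linear_bilinear_compose[OF tensor_lift_linear[OF assms(1) BC assms(4) R] P])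
    fix a b assume a: "a \<in> carrier A" and b: "b \<in> carrier B"
    have "pure_tensor K B C b c \<in> carrier (tensor K B C)"
      by (rule bilinear_maps_closed[OF pure_tensor_bilinear[OF assms(2,3)] b c])
    then show "tensor_lift K M (\<lambda>a u. tensor_lift K M (f a) u)
        (pure_tensor K A (tensor K B C) a (pure_tensor K B C b c)) = f a b c"
      using tensor_lift_pure[OF assms(1) BC assms(4) R a]
        tensor_lift_pure[OF assms(2-4) trilinear_mapsD(1)[OF assms(5) a] b c] by simp
  qed
  also have "\<dots> = tensor_lift K M (\<lambda>t c. tensor_lift K M (\<lambda>a b. f a b c) t)
      (pure_tensor K (tensor K A B) C t c)"
    using tensor_lift_pure[OF AB assms(3,4) L t c] by simp
  finally show "tensor_lift K M (\<lambda>a u. tensor_lift K M (f a) u)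
      (tensor_assoc K A B C (pure_tensor K (tensor K A B) C t c))
      = tensor_lift K M (\<lambda>t c. tensor_lift K M (\<lambda>a b. f a b c) t)
      (pure_tensor K (tensor K A B) C t c)" .
qed (rule assms(6))

text \<open>
  Coassociativity in Sweedler form. The hypothesis on \<open>w\<close> and \<open>w'\<close> says that two
  ways of splitting an element into three factors agree up to rebracketing; the conclusion says that
  every trilinear expression in the three factors has the same value on both.
\<close>

lemma tensor_lift_coassociative:
  assumes "module K A" "module K B" "module K C" "module K P" "module K Q" "module K M"
    "f \<in> trilinear_maps K A B C M"
    "D \<in> linear_maps K P (tensor K A B)" "E \<in> linear_maps K Q (tensor K B C)"
    "w \<in> carrier (tensor K P C)" "w' \<in> carrier (tensor K A Q)"
    "tensor_assoc K A B C (tensor_map K (tensor K A B) C D id w)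
      = tensor_map K A (tensor K B C) id E w'"
  shows "tensor_lift K M (\<lambda>p c. tensor_lift K M (\<lambda>a b. f a b c) (D p)) w
    = tensor_lift K M (\<lambda>a q. tensor_lift K M (\<lambda>b c. f a b c) (E q)) w'"
proof -
  note AB = tensor_module[OF assms(1,2)] and BC = tensor_module[OF assms(2,3)]
  note R = tensor_lift_trilinear_right[OF assms(1-3,6,7)]
    and L = tensor_lift_trilinear_left[OF assms(1-3,6,7)]
  note id = linear_map_id[folded id_def]
  note Did = tensor_map_linear[OF AB assms(3,4,3,8) id]
  have "tensor_lift K M (\<lambda>p c. tensor_lift K M (\<lambda>a b. f a b c) (D p)) w
      = tensor_lift K M (\<lambda>t c. tensor_lift K M (\<lambda>a b. f a b c) t) (tensor_map K (tensor K A B) C D id w)"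
    using tensor_lift_tensor_map[OF AB assms(3,4,3,6,8) id L assms(10)] by simp
  also have "\<dots> = tensor_lift K M (\<lambda>a u. tensor_lift K M (f a) u) (tensor_map K A (tensor K B C) id E w')"
    using tensor_lift_tensor_assoc[OF assms(1-3,6,7) linear_maps_closed[OF Did assms(10)]]
    unfolding assms(12) by simp
  also have "\<dots> = tensor_lift K M (\<lambda>a q. tensor_lift K M (\<lambda>b c. f a b c) (E q)) w'"
    using tensor_lift_tensor_map[OF assms(1) BC assms(1,5,6) id assms(9) R assms(11)] by simp
  finally show ?thesis .
qed

text \<open>
  Pure tensors span both sides, and both composites are linear.
\<close>

lemma tensor_bij_betwI:
  assumes "module K A" "module K B" "module K U" "module K V"
    "F \<in> linear_maps K (tensor K A B) (tensor K U V)"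
    "G \<in> linear_maps K (tensor K U V) (tensor K A B)"
    "\<And>a b. a \<in> carrier A \<Longrightarrow> b \<in> carrier B \<Longrightarrow> G (F (pure_tensor K A B a b)) = pure_tensor K A B a b"
    "\<And>u v. u \<in> carrier U \<Longrightarrow> v \<in> carrier V \<Longrightarrow> F (G (pure_tensor K U V u v)) = pure_tensor K U V u v"
  shows "bij_betw F (carrier (tensor K A B)) (carrier (tensor K U V))"
proof (rule bij_betw_byWitness[where f' = G])
  note AB = tensor_module[OF assms(1,2)] and UV = tensor_module[OF assms(3,4)]
  show "\<forall>t \<in> carrier (tensor K A B). G (F t) = t"
    using tensor_ext[OF assms(1,2) AB linear_map_compose[OF assms(6,5)] linear_map_id] assms(7)
    by blast
  show "\<forall>t \<in> carrier (tensor K U V). F (G t) = t"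
    using tensor_ext[OF assms(3,4) UV linear_map_compose[OF assms(5,6)] linear_map_id] assms(8)
    by blast
qed (use linear_maps_closed[OF assms(5)] linear_maps_closed[OF assms(6)] in blast)+

section \<open>Sweedler calculus in a cogroupoid\<close>

lemma scalar_algebra_module:
  assumes "cring K" shows "module K (scalar_algebra K)"
proof -
  interpret cring K by fact
  show ?thesis
    by (intro moduleI abelian_groupI)
      (auto simp: scalar_algebra_def is_cring a_assoc l_distr r_distr m_assoc
        intro: a_comm add.l_inv_ex)
qed

lemma smult_bilinear:
  assumes "module K M"
  shows "(\<lambda>a c. c \<odot>\<^bsub>M\<^esub> a) \<in> bilinear_maps K M (scalar_algebra K) M"
    and "(\<lambda>c a. c \<odot>\<^bsub>M\<^esub> a) \<in> bilinear_maps K (scalar_algebra K) M M"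
proof -
  interpret module K M by fact
  have "(\<lambda>a. c \<odot>\<^bsub>M\<^esub> a) \<in> linear_maps K M M" if "c \<in> carrier K" for c
    using that by (intro linear_mapsI) (auto simp: smult_r_distr smult_assoc1[symmetric] R.m_comm)
  moreover have "(\<lambda>c. c \<odot>\<^bsub>M\<^esub> a) \<in> linear_maps K (scalar_algebra K) M" if "a \<in> carrier M" for a
    using that by (intro linear_mapsI) (auto simp: scalar_algebra_def smult_l_distr smult_assoc1)
  ultimately show "(\<lambda>a c. c \<odot>\<^bsub>M\<^esub> a) \<in> bilinear_maps K M (scalar_algebra K) M"
    and "(\<lambda>c a. c \<odot>\<^bsub>M\<^esub> a) \<in> bilinear_maps K (scalar_algebra K) M M"
    by (auto intro!: bilinear_mapsI simp: scalar_algebra_def)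
qed

lemma mult_bilinear:
  assumes "k_algebra K A"
  shows "(\<lambda>x y. x \<otimes>\<^bsub>A\<^esub> y) \<in> bilinear_maps K A A A"
proof -
  interpret k_algebra K A by fact
  show ?thesis
    by (intro bilinear_mapsI linear_mapsI)
      (auto simp: A.l_distr A.r_distr smult_mult_left smult_mult_right)
qed

context cogroupoid
begin

lemma Alg_module: "X \<in> Ob C \<Longrightarrow> Y \<in> Ob C \<Longrightarrow> module K (Alg C X Y)"
  using Alg_algebra by (blast dest: k_algebra.axioms)

lemma Delta_linear:
  "X \<in> Ob C \<Longrightarrow> Y \<in> Ob C \<Longrightarrow> Z \<in> Ob C
    \<Longrightarrow> Delta C X Y Z \<in> linear_maps K (Alg C X Y) (tensor K (Alg C X Z) (Alg C Z Y))"
  using Delta_algebra_map by (auto simp: algebra_maps_def)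

lemma Eps_linear: "X \<in> Ob C \<Longrightarrow> Eps C X \<in> linear_maps K (Alg C X X) (scalar_algebra K)"
  using Eps_algebra_map by (auto simp: algebra_maps_def)

lemma one_closed: "X \<in> Ob C \<Longrightarrow> Y \<in> Ob C \<Longrightarrow> \<one>\<^bsub>Alg C X Y\<^esub> \<in> carrier (Alg C X Y)"
  using Alg_algebra[of X Y] by (metis k_algebra.axioms(2) ring.ring_simprules(6))

lemma scalar_module: "module K (scalar_algebra K)"
  using scalar_algebra_module is_cring by blast

lemma mult_Ant_bilinear:
  assumes "X \<in> Ob C" "Y \<in> Ob C"
  shows "(\<lambda>a b. a \<otimes>\<^bsub>Alg C X Y\<^esub> Ant C Y X b) \<in> bilinear_maps K (Alg C X Y) (Alg C Y X) (Alg C X Y)"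
    and "(\<lambda>b a. Ant C Y X b \<otimes>\<^bsub>Alg C X Y\<^esub> a) \<in> bilinear_maps K (Alg C Y X) (Alg C X Y) (Alg C X Y)"
  using bilinear_map_compose[OF mult_bilinear[OF Alg_algebra[OF assms]] linear_map_id Ant_linear[OF assms(2,1)]]
    bilinear_map_compose[OF mult_bilinear[OF Alg_algebra[OF assms]] Ant_linear[OF assms(2,1)] linear_map_id]
  by auto

text \<open>
  The antipode identity \<open>p\<^sub>1 S(p\<^sub>2) = \<epsilon>(p) 1\<close> for \<open>p \<in> C(X,X)\<close> split
  through \<open>Y\<close>, under an arbitrary linear map \<open>g\<close>. The generality in \<open>g\<close> is what
  allows it to be applied inside a larger Sweedler expression.
\<close>

lemma tensor_lift_Ant_right:
  assumes X: "X \<in> Ob C" and Y: "Y \<in> Ob C" and M: "module K M"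
    and g: "g \<in> linear_maps K (Alg C X Y) M" and p: "p \<in> carrier (Alg C X X)"
  shows "tensor_lift K M (\<lambda>a b. g (a \<otimes>\<^bsub>Alg C X Y\<^esub> Ant C Y X b)) (Delta C X X Y p)
    = Eps C X p \<odot>\<^bsub>M\<^esub> g \<one>\<^bsub>Alg C X Y\<^esub>"
proof -
  note XY = Alg_module[OF X Y] and YX = Alg_module[OF Y X]
  note D = linear_maps_closed[OF Delta_linear[OF X X Y] p]
  have "tensor_lift K M (\<lambda>a b. g (a \<otimes>\<^bsub>Alg C X Y\<^esub> Ant C Y X b)) (Delta C X X Y p)
      = g (tensor_lift K (Alg C X Y) (\<lambda>a b. a \<otimes>\<^bsub>Alg C X Y\<^esub> Ant C Y X b) (Delta C X X Y p))"
    by (rule linear_tensor_lift[OF XY YX XY M mult_Ant_bilinear(1)[OF X Y] g D, symmetric])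
  also have "tensor_lift K (Alg C X Y) (\<lambda>a b. a \<otimes>\<^bsub>Alg C X Y\<^esub> Ant C Y X b) (Delta C X X Y p)
      = Eps C X p \<odot>\<^bsub>Alg C X Y\<^esub> \<one>\<^bsub>Alg C X Y\<^esub>"
    using Ant_right[OF X Y p] tensor_lift_tensor_map[OF XY XY XY YX XY linear_map_id[folded id_def]
      Ant_linear[OF Y X] mult_bilinear[OF Alg_algebra[OF X Y]] D]
    by (simp add: mult_map_def)
  also have "g \<dots> = Eps C X p \<odot>\<^bsub>M\<^esub> g \<one>\<^bsub>Alg C X Y\<^esub>"
    using linear_maps_closed[OF Eps_linear[OF X] p]
    by (intro linear_maps_smult[OF g] one_closed X Y) (simp add: scalar_algebra_def)
  finally show ?thesis .
qed

text \<open>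
  The mirror identity \<open>S(q\<^sub>1) q\<^sub>2 = \<epsilon>(q) 1\<close>. Here \<open>q\<close> lies in
  \<open>C(Y,Y)\<close> and is split through \<open>X\<close>, so that the product again lands in
  \<open>C(X,Y)\<close> and uses the same antipode \<open>S\<^sub>Y\<^sub>X\<close> as \<open>tensor_lift_Ant_right\<close>.
\<close>

lemma tensor_lift_Ant_left:
  assumes X: "X \<in> Ob C" and Y: "Y \<in> Ob C" and M: "module K M"
    and g: "g \<in> linear_maps K (Alg C X Y) M" and q: "q \<in> carrier (Alg C Y Y)"
  shows "tensor_lift K M (\<lambda>b a. g (Ant C Y X b \<otimes>\<^bsub>Alg C X Y\<^esub> a)) (Delta C Y Y X q)
    = Eps C Y q \<odot>\<^bsub>M\<^esub> g \<one>\<^bsub>Alg C X Y\<^esub>"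
proof -
  note XY = Alg_module[OF X Y] and YX = Alg_module[OF Y X]
  note D = linear_maps_closed[OF Delta_linear[OF Y Y X] q]
  have "tensor_lift K M (\<lambda>b a. g (Ant C Y X b \<otimes>\<^bsub>Alg C X Y\<^esub> a)) (Delta C Y Y X q)
      = g (tensor_lift K (Alg C X Y) (\<lambda>b a. Ant C Y X b \<otimes>\<^bsub>Alg C X Y\<^esub> a) (Delta C Y Y X q))"
    by (rule linear_tensor_lift[OF YX XY XY M mult_Ant_bilinear(2)[OF X Y] g D, symmetric])
  also have "tensor_lift K (Alg C X Y) (\<lambda>b a. Ant C Y X b \<otimes>\<^bsub>Alg C X Y\<^esub> a) (Delta C Y Y X q)
      = Eps C Y q \<odot>\<^bsub>Alg C X Y\<^esub> \<one>\<^bsub>Alg C X Y\<^esub>"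
    using Ant_left[OF Y X q] tensor_lift_tensor_map[OF XY XY YX XY XY Ant_linear[OF Y X]
      linear_map_id[folded id_def] mult_bilinear[OF Alg_algebra[OF X Y]] D]
    by (simp add: mult_map_def)
  also have "g \<dots> = Eps C Y q \<odot>\<^bsub>M\<^esub> g \<one>\<^bsub>Alg C X Y\<^esub>"
    using linear_maps_closed[OF Eps_linear[OF Y] q]
    by (intro linear_maps_smult[OF g] one_closed X Y) (simp add: scalar_algebra_def)
  finally show ?thesis .
qed

lemma tensor_lift_counit_right:
  assumes X: "X \<in> Ob C" and Y: "Y \<in> Ob C" and M: "module K M"
    and g: "g \<in> linear_maps K (Alg C X Y) M" and x: "x \<in> carrier (Alg C X Y)"
  shows "tensor_lift K M (\<lambda>a q. Eps C Y q \<odot>\<^bsub>M\<^esub> g a) (Delta C X Y Y x) = g x"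
proof -
  note XY = Alg_module[OF X Y] and YY = Alg_module[OF Y Y]
  note D = linear_maps_closed[OF Delta_linear[OF X Y Y] x]
  note sm = smult_bilinear(1)[OF XY]
  have bil: "(\<lambda>a q. Eps C Y q \<odot>\<^bsub>Alg C X Y\<^esub> a) \<in> bilinear_maps K (Alg C X Y) (Alg C Y Y) (Alg C X Y)"
    by (rule bilinear_map_compose[OF sm linear_map_id Eps_linear[OF Y]])
  have "x = tensor_lift K (Alg C X Y) (\<lambda>a q. Eps C Y q \<odot>\<^bsub>Alg C X Y\<^esub> a) (Delta C X Y Y x)"
    using counit_right[OF X Y x] tensor_lift_tensor_map[OF XY scalar_module XY YY XY
        linear_map_id[folded id_def] Eps_linear[OF Y] sm D]
    by (simp add: tensor_unit_right_def)
  then have "g x = g (tensor_lift K (Alg C X Y) (\<lambda>a q. Eps C Y q \<odot>\<^bsub>Alg C X Y\<^esub> a) (Delta C X Y Y x))"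
    by simp
  also have "\<dots> = tensor_lift K M (\<lambda>a q. g (Eps C Y q \<odot>\<^bsub>Alg C X Y\<^esub> a)) (Delta C X Y Y x)"
    by (rule linear_tensor_lift[OF XY YY XY M bil g D])
  also have "\<dots> = tensor_lift K M (\<lambda>a q. Eps C Y q \<odot>\<^bsub>M\<^esub> g a) (Delta C X Y Y x)"
    using linear_maps_closed[OF Eps_linear[OF Y]]
    by (intro tensor_lift_cong[OF XY YY M linear_bilinear_compose[OF g bil] D] linear_maps_smult[OF g])
      (auto simp: scalar_algebra_def)
  finally show ?thesis by simp
qed

lemma tensor_lift_counit_left:
  assumes X: "X \<in> Ob C" and Y: "Y \<in> Ob C" and M: "module K M"
    and g: "g \<in> linear_maps K (Alg C X Y) M" and x: "x \<in> carrier (Alg C X Y)"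
  shows "tensor_lift K M (\<lambda>p a. Eps C X p \<odot>\<^bsub>M\<^esub> g a) (Delta C X Y X x) = g x"
proof -
  note XY = Alg_module[OF X Y] and XX = Alg_module[OF X X]
  note D = linear_maps_closed[OF Delta_linear[OF X Y X] x]
  note sm = smult_bilinear(2)[OF XY]
  have bil: "(\<lambda>p a. Eps C X p \<odot>\<^bsub>Alg C X Y\<^esub> a) \<in> bilinear_maps K (Alg C X X) (Alg C X Y) (Alg C X Y)"
    by (rule bilinear_map_compose[OF sm Eps_linear[OF X] linear_map_id])
  have "x = tensor_lift K (Alg C X Y) (\<lambda>p a. Eps C X p \<odot>\<^bsub>Alg C X Y\<^esub> a) (Delta C X Y X x)"
    using counit_left[OF X Y x] tensor_lift_tensor_map[OF scalar_module XY XX XY XY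
        Eps_linear[OF X] linear_map_id[folded id_def] sm D]
    by (simp add: tensor_unit_left_def)
  then have "g x = g (tensor_lift K (Alg C X Y) (\<lambda>p a. Eps C X p \<odot>\<^bsub>Alg C X Y\<^esub> a) (Delta C X Y X x))"
    by simp
  also have "\<dots> = tensor_lift K M (\<lambda>p a. g (Eps C X p \<odot>\<^bsub>Alg C X Y\<^esub> a)) (Delta C X Y X x)"
    by (rule linear_tensor_lift[OF XX XY XY M bil g D])
  also have "\<dots> = tensor_lift K M (\<lambda>p a. Eps C X p \<odot>\<^bsub>M\<^esub> g a) (Delta C X Y X x)"
    using linear_maps_closed[OF Eps_linear[OF X]]
    by (intro tensor_lift_cong[OF XX XY M linear_bilinear_compose[OF g bil] D] linear_maps_smult[OF g])
      (auto simp: scalar_algebra_def)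
  finally show ?thesis by simp
qed

lemma tensor_lift_Delta_coassociative:
  assumes Ob: "X \<in> Ob C" "Y \<in> Ob C" "Z \<in> Ob C" "T \<in> Ob C" and M: "module K M"
    and f: "f \<in> trilinear_maps K (Alg C X T) (Alg C T Z) (Alg C Z Y) M"
    and a: "a \<in> carrier (Alg C X Y)"
  shows "tensor_lift K M (\<lambda>p c. tensor_lift K M (\<lambda>a b. f a b c) (Delta C X Z T p)) (Delta C X Y Z a)
    = tensor_lift K M (\<lambda>a q. tensor_lift K M (\<lambda>b c. f a b c) (Delta C T Y Z q)) (Delta C X Y T a)"
proof -
  note X = Ob(1) and Y = Ob(2) and Z = Ob(3) and T = Ob(4)
  show ?thesis
    by (rule tensor_lift_coassociative[OF Alg_module[OF X T] Alg_module[OF T Z] Alg_module[OF Z Y]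
          Alg_module[OF X Z] Alg_module[OF T Y] M f Delta_linear[OF X Z T] Delta_linear[OF T Y Z]
          linear_maps_closed[OF Delta_linear[OF X Y Z] a]
          linear_maps_closed[OF Delta_linear[OF X Y T] a] coassociative[OF X Y Z T a]])
qed

lemma tensor_lift_Delta_nested_bilinear:
  assumes Ob: "X \<in> Ob C" "Y \<in> Ob C" "Z \<in> Ob C" "T \<in> Ob C" and M: "module K M"
    and f: "f \<in> trilinear_maps K (Alg C X T) (Alg C T Z) (Alg C Z Y) M"
  shows "(\<lambda>p c. tensor_lift K M (\<lambda>a b. f a b c) (Delta C X Z T p))
      \<in> bilinear_maps K (Alg C X Z) (Alg C Z Y) M"
    and "(\<lambda>a q. tensor_lift K M (\<lambda>b c. f a b c) (Delta C T Y Z q))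
      \<in> bilinear_maps K (Alg C X T) (Alg C T Y) M"
proof -
  note X = Ob(1) and Y = Ob(2) and Z = Ob(3) and T = Ob(4)
  note mods = Alg_module[OF X T] Alg_module[OF T Z] Alg_module[OF Z Y]
  show "(\<lambda>p c. tensor_lift K M (\<lambda>a b. f a b c) (Delta C X Z T p))
      \<in> bilinear_maps K (Alg C X Z) (Alg C Z Y) M"
    by (rule bilinear_map_compose[OF tensor_lift_trilinear_left[OF mods M f]
          Delta_linear[OF X Z T] linear_map_id])
  show "(\<lambda>a q. tensor_lift K M (\<lambda>b c. f a b c) (Delta C T Y Z q))
      \<in> bilinear_maps K (Alg C X T) (Alg C T Y) M"
    by (rule bilinear_map_compose[OF tensor_lift_trilinear_right[OF mods M f]
          linear_map_id Delta_linear[OF T Y Z]])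
qed

text \<open>
  The next four lemmas are the cancellations \<open>x\<^sub>1 \<otimes> S(x\<^sub>2) x\<^sub>3 = x \<otimes> 1\<close>,
  \<open>h\<^sub>1 \<otimes> h\<^sub>2 S(h\<^sub>3) = h \<otimes> 1\<close>,
  \<open>y\<^sub>1 S(y\<^sub>2) \<otimes> y\<^sub>3 = 1 \<otimes> y\<close> and
  \<open>S(l\<^sub>1) l\<^sub>2 \<otimes> l\<^sub>3 = 1 \<otimes> l\<close>, one for each composite of a canonical map
  with its inverse. In every case the composite arrives bracketed the wrong way; coassociativity
  regroups the three factors so that the antipode and its partner come from splitting one element of
  a vertex algebra. The antipode identity turns that pair into a counit, which the counit law absorbs.
\<close>

lemma cancel_Ant_left_second:
  assumes X: "X \<in> Ob C" and Y: "Y \<in> Ob C" and M: "module K M"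
    and G: "G \<in> bilinear_maps K (Alg C X Y) (Alg C X Y) M" and x: "x \<in> carrier (Alg C X Y)"
  shows "tensor_lift K M (\<lambda>p a. tensor_lift K M (\<lambda>b c. G b (Ant C Y X c \<otimes>\<^bsub>Alg C X Y\<^esub> a))
      (Delta C X X Y p)) (Delta C X Y X x) = G x \<one>\<^bsub>Alg C X Y\<^esub>"
proof -
  note f = nested_bilinear_trilinear[OF G mult_Ant_bilinear(2)[OF X Y]]
  have "tensor_lift K M (\<lambda>p a. tensor_lift K M (\<lambda>b c. G b (Ant C Y X c \<otimes>\<^bsub>Alg C X Y\<^esub> a))
      (Delta C X X Y p)) (Delta C X Y X x)
      = tensor_lift K M (\<lambda>b q. tensor_lift K M (\<lambda>c a. G b (Ant C Y X c \<otimes>\<^bsub>Alg C X Y\<^esub> a))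
      (Delta C Y Y X q)) (Delta C X Y Y x)"
    by (rule tensor_lift_Delta_coassociative[OF X Y X Y M f x])
  also have "\<dots> = tensor_lift K M (\<lambda>b q. Eps C Y q \<odot>\<^bsub>M\<^esub> G b \<one>\<^bsub>Alg C X Y\<^esub>) (Delta C X Y Y x)"
    using tensor_lift_Ant_left[OF X Y M bilinear_maps_right[OF G]]
    by (intro tensor_lift_cong[OF Alg_module[OF X Y] Alg_module[OF Y Y] M
          tensor_lift_Delta_nested_bilinear(2)[OF X Y X Y M f]]
        linear_maps_closed[OF Delta_linear[OF X Y Y] x]) auto
  also have "\<dots> = G x \<one>\<^bsub>Alg C X Y\<^esub>"
    by (rule tensor_lift_counit_right[OF X Y M bilinear_maps_left[OF G one_closed[OF X Y]] x])
  finally show ?thesis .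
qed

lemma cancel_Ant_right_second:
  assumes X: "X \<in> Ob C" and Y: "Y \<in> Ob C" and M: "module K M"
    and G: "G \<in> bilinear_maps K (Alg C X X) (Alg C X Y) M" and h: "h \<in> carrier (Alg C X X)"
  shows "tensor_lift K M (\<lambda>a b. tensor_lift K M (\<lambda>h a. G h (a \<otimes>\<^bsub>Alg C X Y\<^esub> Ant C Y X b))
      (Delta C X Y X a)) (Delta C X X Y h) = G h \<one>\<^bsub>Alg C X Y\<^esub>"
proof -
  note f = nested_bilinear_trilinear[OF G mult_Ant_bilinear(1)[OF X Y]]
  have "tensor_lift K M (\<lambda>a b. tensor_lift K M (\<lambda>h a. G h (a \<otimes>\<^bsub>Alg C X Y\<^esub> Ant C Y X b))
      (Delta C X Y X a)) (Delta C X X Y h)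
      = tensor_lift K M (\<lambda>h q. tensor_lift K M (\<lambda>a b. G h (a \<otimes>\<^bsub>Alg C X Y\<^esub> Ant C Y X b))
      (Delta C X X Y q)) (Delta C X X X h)"
    by (rule tensor_lift_Delta_coassociative[OF X X Y X M f h])
  also have "\<dots> = tensor_lift K M (\<lambda>h q. Eps C X q \<odot>\<^bsub>M\<^esub> G h \<one>\<^bsub>Alg C X Y\<^esub>) (Delta C X X X h)"
    using tensor_lift_Ant_right[OF X Y M bilinear_maps_right[OF G]]
    by (intro tensor_lift_cong[OF Alg_module[OF X X] Alg_module[OF X X] M
          tensor_lift_Delta_nested_bilinear(2)[OF X X Y X M f]]
        linear_maps_closed[OF Delta_linear[OF X X X] h]) auto
  also have "\<dots> = G h \<one>\<^bsub>Alg C X Y\<^esub>"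
    by (rule tensor_lift_counit_right[OF X X M bilinear_maps_left[OF G one_closed[OF X Y]] h])
  finally show ?thesis .
qed

lemma cancel_Ant_right_first:
  assumes X: "X \<in> Ob C" and Y: "Y \<in> Ob C" and M: "module K M"
    and G: "G \<in> bilinear_maps K (Alg C X Y) (Alg C X Y) M" and y: "y \<in> carrier (Alg C X Y)"
  shows "tensor_lift K M (\<lambda>a q. tensor_lift K M (\<lambda>b c. G (a \<otimes>\<^bsub>Alg C X Y\<^esub> Ant C Y X b) c)
      (Delta C Y Y X q)) (Delta C X Y Y y) = G \<one>\<^bsub>Alg C X Y\<^esub> y"
proof -
  note f = nested_bilinear_trilinear'[OF G mult_Ant_bilinear(1)[OF X Y]]
  have "tensor_lift K M (\<lambda>a q. tensor_lift K M (\<lambda>b c. G (a \<otimes>\<^bsub>Alg C X Y\<^esub> Ant C Y X b) c)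
      (Delta C Y Y X q)) (Delta C X Y Y y)
      = tensor_lift K M (\<lambda>p c. tensor_lift K M (\<lambda>a b. G (a \<otimes>\<^bsub>Alg C X Y\<^esub> Ant C Y X b) c)
      (Delta C X X Y p)) (Delta C X Y X y)"
    by (rule tensor_lift_Delta_coassociative[OF X Y X Y M f y, symmetric])
  also have "\<dots> = tensor_lift K M (\<lambda>p c. Eps C X p \<odot>\<^bsub>M\<^esub> G \<one>\<^bsub>Alg C X Y\<^esub> c) (Delta C X Y X y)"
    using tensor_lift_Ant_right[OF X Y M bilinear_maps_left[OF G]]
    by (intro tensor_lift_cong[OF Alg_module[OF X X] Alg_module[OF X Y] M
          tensor_lift_Delta_nested_bilinear(1)[OF X Y X Y M f]]
        linear_maps_closed[OF Delta_linear[OF X Y X] y]) auto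
  also have "\<dots> = G \<one>\<^bsub>Alg C X Y\<^esub> y"
    by (rule tensor_lift_counit_left[OF X Y M bilinear_maps_right[OF G one_closed[OF X Y]] y])
  finally show ?thesis .
qed

lemma cancel_Ant_left_first:
  assumes X: "X \<in> Ob C" and Y: "Y \<in> Ob C" and M: "module K M"
    and G: "G \<in> bilinear_maps K (Alg C X Y) (Alg C Y Y) M" and l: "l \<in> carrier (Alg C Y Y)"
  shows "tensor_lift K M (\<lambda>b a. tensor_lift K M (\<lambda>a l. G (Ant C Y X b \<otimes>\<^bsub>Alg C X Y\<^esub> a) l)
      (Delta C X Y Y a)) (Delta C Y Y X l) = G \<one>\<^bsub>Alg C X Y\<^esub> l"
proof -
  note f = nested_bilinear_trilinear'[OF G mult_Ant_bilinear(2)[OF X Y]]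
  have "tensor_lift K M (\<lambda>b a. tensor_lift K M (\<lambda>a l. G (Ant C Y X b \<otimes>\<^bsub>Alg C X Y\<^esub> a) l)
      (Delta C X Y Y a)) (Delta C Y Y X l)
      = tensor_lift K M (\<lambda>p l. tensor_lift K M (\<lambda>b a. G (Ant C Y X b \<otimes>\<^bsub>Alg C X Y\<^esub> a) l)
      (Delta C Y Y X p)) (Delta C Y Y Y l)"
    by (rule tensor_lift_Delta_coassociative[OF Y Y Y X M f l, symmetric])
  also have "\<dots> = tensor_lift K M (\<lambda>p l. Eps C Y p \<odot>\<^bsub>M\<^esub> G \<one>\<^bsub>Alg C X Y\<^esub> l) (Delta C Y Y Y l)"
    using tensor_lift_Ant_left[OF X Y M bilinear_maps_left[OF G]]
    by (intro tensor_lift_cong[OF Alg_module[OF Y Y] Alg_module[OF Y Y] M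
          tensor_lift_Delta_nested_bilinear(1)[OF Y Y Y X M f]]
        linear_maps_closed[OF Delta_linear[OF Y Y Y] l]) auto
  also have "\<dots> = G \<one>\<^bsub>Alg C X Y\<^esub> l"
    by (rule tensor_lift_counit_left[OF Y Y M bilinear_maps_right[OF G one_closed[OF X Y]] l])
  finally show ?thesis .
qed

end

section \<open>Vertex Hopf algebras\<close>

text \<open>
  The Hopf algebra at a vertex is a longer record over the same algebra. Every construction on tensor
  products reads only the algebra fields, so the simplification rules below replace the Hopf algebra
  by \<open>C(X,X)\<close> wherever it occurs as a factor.
\<close>

lemma vertex_hopf_algebra_sel [simp]:
  "carrier (vertex_hopf_algebra C X) = carrier (Alg C X X)"
  "zero (vertex_hopf_algebra C X) = zero (Alg C X X)"
  "add (vertex_hopf_algebra C X) = add (Alg C X X)"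
  "one (vertex_hopf_algebra C X) = one (Alg C X X)"
  "mult (vertex_hopf_algebra C X) = mult (Alg C X X)"
  "smult (vertex_hopf_algebra C X) = smult (Alg C X X)"
  "comult (vertex_hopf_algebra C X) = Delta C X X X"
  "counit (vertex_hopf_algebra C X) = Eps C X"
  "antipode (vertex_hopf_algebra C X) = Ant C X X"
  by (simp_all add: vertex_hopf_algebra_def module.defs hopf_algebra.defs)

lemma tensor_vertex [simp]:
  "tensor K (vertex_hopf_algebra C X) B = tensor K (Alg C X X) B"
  "tensor K A (vertex_hopf_algebra C X) = tensor K A (Alg C X X)"
  "pure_tensor K (vertex_hopf_algebra C X) B = pure_tensor K (Alg C X X) B"
  "pure_tensor K A (vertex_hopf_algebra C X) = pure_tensor K A (Alg C X X)"
  by (simp_all add: tensor_def tensor_space_def tensor_null_def tensor_relations_def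
      pure_tensor_def fun_eq_iff)

lemma tensor_map_vertex [simp]:
  "tensor_map K (vertex_hopf_algebra C X) B f g = tensor_map K (Alg C X X) B f g"
  "tensor_map K A (vertex_hopf_algebra C X) f' g' = tensor_map K A (Alg C X X) f' g'"
  by (simp_all add: tensor_map_def)

lemma tensor_assoc_vertex [simp]:
  "tensor_assoc K (vertex_hopf_algebra C X) A B = tensor_assoc K (Alg C X X) A B"
  "tensor_assoc K A (vertex_hopf_algebra C X) B = tensor_assoc K A (Alg C X X) B"
  "tensor_assoc K A B (vertex_hopf_algebra C X) = tensor_assoc K A B (Alg C X X)"
  "tensor_assoc_inv K A B (vertex_hopf_algebra C X) = tensor_assoc_inv K A B (Alg C X X)"
  by (simp_all add: tensor_assoc_def tensor_assoc_inv_def)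

lemma tensor_lift_vertex [simp]:
  "tensor_lift K (vertex_hopf_algebra C X) \<phi> = tensor_lift K (Alg C X X) \<phi>"
  by (simp add: tensor_lift_def fun_eq_iff finsum_def finprod_def)

lemma linear_maps_vertex [simp]:
  "linear_maps K (vertex_hopf_algebra C X) M = linear_maps K (Alg C X X) M"
  "linear_maps K M (vertex_hopf_algebra C X) = linear_maps K M (Alg C X X)"
  "ring_hom (vertex_hopf_algebra C X) M' = ring_hom (Alg C X X) M'"
  by (simp_all add: linear_maps_def ring_hom_def)

lemma k_algebra_vertex:
  assumes "k_algebra K (Alg C X X)"
  shows "k_algebra K (vertex_hopf_algebra C X)"
proof -
  interpret k_algebra K "Alg C X X" by fact
  have mod: "module K (vertex_hopf_algebra C X)"
    by (rule module_record_cong[OF module_axioms]) simp_all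
  have "ring (vertex_hopf_algebra C X)"
    by (rule ringI)
      (auto simp: A.l_distr A.r_distr A.m_assoc intro: module.axioms(2)[OF mod] monoidI)
  then show ?thesis
    using mod K.field_axioms
    by (intro k_algebra.intro k_algebra_axioms.intro)
      (auto simp: smult_mult_left smult_mult_right)
qed

lemma (in cogroupoid) hopf_algebra_vertex:
  assumes X: "X \<in> Ob C"
  shows "hopf_algebra K (vertex_hopf_algebra C X)"
proof (intro hopf_algebra.intro hopf_algebra_axioms.intro k_algebra_vertex Alg_algebra X)
qed (use Delta_algebra_map[OF X X X] Eps_algebra_map[OF X] Ant_linear[OF X X]
    coassociative[OF X X X X] counit_right[OF X X] counit_left[OF X X]
    Ant_right[OF X X] Ant_left[OF X X] in
    \<open>simp_all add: algebra_maps_def mult_map_def tensor_unit_left_def tensor_unit_right_def\<close>)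

section \<open>The canonical maps and their inverses\<close>

lemma mult_map_linear:
  assumes "k_algebra K A" shows "mult_map K A \<in> linear_maps K (tensor K A A) A"
proof -
  interpret k_algebra K A by fact
  show ?thesis unfolding mult_map_def
    by (intro tensor_lift_linear mult_bilinear assms module_axioms)
qed

lemma mult_map_pure:
  assumes "k_algebra K A" "x \<in> carrier A" "y \<in> carrier A"
  shows "mult_map K A (pure_tensor K A A x y) = x \<otimes>\<^bsub>A\<^esub> y"
proof -
  interpret k_algebra K A by fact
  show ?thesis unfolding mult_map_def
    by (rule tensor_lift_pure[OF module_axioms module_axioms module_axioms mult_bilinear[OF assms(1)] assms(2,3)])
qed

lemma left_canonical_map_linear:
  assumes A: "k_algebra K A" and H: "module K H" and \<alpha>: "\<alpha> \<in> linear_maps K A (tensor K H A)"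
  shows "left_canonical_map K H A \<alpha> \<in> linear_maps K (tensor K A A) (tensor K H A)"
proof -
  note Am = k_algebra.axioms(3)[OF A]
  note id = linear_map_id[folded id_def]
  note HA = tensor_module[OF H Am] and AA = tensor_module[OF Am Am]
  show ?thesis
    unfolding left_canonical_map_def comp_def
    by (rule linear_map_compose[OF tensor_map_linear[OF H Am H AA id mult_map_linear[OF A]]
          linear_map_compose[OF tensor_assoc_linear[OF H Am Am] tensor_map_linear[OF HA Am Am Am \<alpha> id]]])
qed

text \<open>
  In Sweedler notation the left canonical map is \<open>x \<otimes> y \<mapsto> x\<^sub>1 \<otimes> x\<^sub>2 y\<close>.
\<close>

lemma left_canonical_map_pure:
  assumes A: "k_algebra K A" and H: "module K H" and \<alpha>: "\<alpha> \<in> linear_maps K A (tensor K H A)"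
    and x: "x \<in> carrier A" and y: "y \<in> carrier A"
  shows "left_canonical_map K H A \<alpha> (pure_tensor K A A x y)
    = tensor_lift K (tensor K H A) (\<lambda>h a. pure_tensor K H A h (a \<otimes>\<^bsub>A\<^esub> y)) (\<alpha> x)"
proof -
  note Am = k_algebra.axioms(3)[OF A]
  note id = linear_map_id[folded id_def]
  note HA = tensor_module[OF H Am] and AA = tensor_module[OF Am Am]
  note lin = tensor_map_linear[OF H Am H AA id mult_map_linear[OF A]]
  note ax = linear_maps_closed[OF \<alpha> x]
  note P = trilinear_mapsD(2)[OF pure_pure_trilinear(1)[OF H Am Am] y]
  have "left_canonical_map K H A \<alpha> (pure_tensor K A A x y)
    = tensor_map K H A id (mult_map K A) (tensor_assoc K H A A (pure_tensor K (tensor K H A) A (\<alpha> x) y))"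
    using tensor_map_pure[OF HA Am Am Am \<alpha> id x y] by (simp add: left_canonical_map_def)
  also have "\<dots> = tensor_lift K (tensor K H A) (\<lambda>h a. tensor_map K H A id (mult_map K A)
      (pure_tensor K H (tensor K A A) h (pure_tensor K A A a y))) (\<alpha> x)"
    unfolding tensor_assoc_pure[OF H Am Am ax y]
    by (rule linear_tensor_lift[OF H Am tensor_module[OF H AA] HA P lin ax])
  also have "\<dots> = tensor_lift K (tensor K H A) (\<lambda>h a. pure_tensor K H A h (a \<otimes>\<^bsub>A\<^esub> y)) (\<alpha> x)"
  proof (rule tensor_lift_cong[OF H Am HA linear_bilinear_compose[OF lin P] ax])
    fix h a assume h: "h \<in> carrier H" and a: "a \<in> carrier A"
    show "tensor_map K H A id (mult_map K A) (pure_tensor K H (tensor K A A) h (pure_tensor K A A a y))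
        = pure_tensor K H A h (a \<otimes>\<^bsub>A\<^esub> y)"
      using tensor_map_pure[OF H Am H AA id mult_map_linear[OF A] h
          bilinear_maps_closed[OF pure_tensor_bilinear[OF Am Am] a y]]
      by (simp add: mult_map_pure[OF A a y])
  qed
  finally show ?thesis .
qed

lemma right_canonical_map_linear:
  assumes A: "k_algebra K A" and L: "module K L" and \<beta>: "\<beta> \<in> linear_maps K A (tensor K A L)"
  shows "right_canonical_map K L A \<beta> \<in> linear_maps K (tensor K A A) (tensor K A L)"
proof -
  note Am = k_algebra.axioms(3)[OF A]
  note id = linear_map_id[folded id_def]
  note AL = tensor_module[OF Am L] and AA = tensor_module[OF Am Am]
  show ?thesis
    unfolding right_canonical_map_def comp_def
    by (rule linear_map_compose[OF tensor_map_linear[OF Am L AA L mult_map_linear[OF A] id]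
          linear_map_compose[OF tensor_assoc_inv_linear[OF Am Am L] tensor_map_linear[OF Am AL Am Am id \<beta>]]])
qed

text \<open>
  In Sweedler notation the right canonical map is \<open>x \<otimes> y \<mapsto> x y\<^sub>1 \<otimes> y\<^sub>2\<close>.
\<close>

lemma right_canonical_map_pure:
  assumes A: "k_algebra K A" and L: "module K L" and \<beta>: "\<beta> \<in> linear_maps K A (tensor K A L)"
    and x: "x \<in> carrier A" and y: "y \<in> carrier A"
  shows "right_canonical_map K L A \<beta> (pure_tensor K A A x y)
    = tensor_lift K (tensor K A L) (\<lambda>a l. pure_tensor K A L (x \<otimes>\<^bsub>A\<^esub> a) l) (\<beta> y)"
proof -
  note Am = k_algebra.axioms(3)[OF A]
  note id = linear_map_id[folded id_def]
  note AL = tensor_module[OF Am L] and AA = tensor_module[OF Am Am]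
  note lin = tensor_map_linear[OF Am L AA L mult_map_linear[OF A] id]
  note b = linear_maps_closed[OF \<beta> y]
  note P = trilinear_mapsD(1)[OF pure_pure_trilinear(2)[OF Am Am L] x]
  have "right_canonical_map K L A \<beta> (pure_tensor K A A x y)
    = tensor_map K A L (mult_map K A) id (tensor_assoc_inv K A A L (pure_tensor K A (tensor K A L) x (\<beta> y)))"
    using tensor_map_pure[OF Am AL Am Am id \<beta> x y] by (simp add: right_canonical_map_def)
  also have "\<dots> = tensor_lift K (tensor K A L) (\<lambda>a l. tensor_map K A L (mult_map K A) id
      (pure_tensor K (tensor K A A) L (pure_tensor K A A x a) l)) (\<beta> y)"
    unfolding tensor_assoc_inv_pure[OF Am Am L x b]
    by (rule linear_tensor_lift[OF Am L tensor_module[OF AA L] AL P lin b])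
  also have "\<dots> = tensor_lift K (tensor K A L) (\<lambda>a l. pure_tensor K A L (x \<otimes>\<^bsub>A\<^esub> a) l) (\<beta> y)"
  proof (rule tensor_lift_cong[OF Am L AL linear_bilinear_compose[OF lin P] b])
    fix a l assume a: "a \<in> carrier A" and l: "l \<in> carrier L"
    show "tensor_map K A L (mult_map K A) id (pure_tensor K (tensor K A A) L (pure_tensor K A A x a) l)
        = pure_tensor K A L (x \<otimes>\<^bsub>A\<^esub> a) l"
      using tensor_map_pure[OF Am L AA L mult_map_linear[OF A] id
          bilinear_maps_closed[OF pure_tensor_bilinear[OF Am Am] x a] l]
      by (simp add: mult_map_pure[OF A x a])
  qed
  finally show ?thesis .
qed

context cogroupoid
begin

text \<open>
  The map \<open>h \<otimes> y \<mapsto> h\<^sub>1 \<otimes> S(h\<^sub>2) y\<close>. Splitting \<open>h \<in> C(X,X)\<close> through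
  \<open>Y\<close> puts \<open>h\<^sub>1\<close> into \<open>C(X,Y)\<close> and \<open>h\<^sub>2\<close> into \<open>C(Y,X)\<close>, which
  the antipode sends back to \<open>C(X,Y)\<close>.
\<close>

definition left_canonical_inverse :: "'o \<Rightarrow> 'o \<Rightarrow> ('k, 'a, 'a) tensor \<Rightarrow> ('k, 'a, 'a) tensor"
  where "left_canonical_inverse X Y =
    tensor_lift K (tensor K (Alg C X Y) (Alg C X Y)) (\<lambda>h y.
      tensor_lift K (tensor K (Alg C X Y) (Alg C X Y)) (\<lambda>a b.
        pure_tensor K (Alg C X Y) (Alg C X Y) a (Ant C Y X b \<otimes>\<^bsub>Alg C X Y\<^esub> y)) (Delta C X X Y h))"

text \<open>
  The map \<open>x \<otimes> l \<mapsto> x S(l\<^sub>1) \<otimes> l\<^sub>2\<close>, with \<open>l \<in> C(Y,Y)\<close> split through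
  \<open>X\<close>.
\<close>

definition right_canonical_inverse :: "'o \<Rightarrow> 'o \<Rightarrow> ('k, 'a, 'a) tensor \<Rightarrow> ('k, 'a, 'a) tensor"
  where "right_canonical_inverse X Y =
    tensor_lift K (tensor K (Alg C X Y) (Alg C X Y)) (\<lambda>x l.
      tensor_lift K (tensor K (Alg C X Y) (Alg C X Y)) (\<lambda>b a.
        pure_tensor K (Alg C X Y) (Alg C X Y) (x \<otimes>\<^bsub>Alg C X Y\<^esub> Ant C Y X b) a) (Delta C Y Y X l))"

text \<open>
  Both composites are reduced, by associativity in \<open>C(X,Y)\<close>, to a cancellation lemma applied to
  the bilinear map \<open>G(b, u) = b \<otimes> u y\<close>: the factor \<open>y\<close> is carried along
  on the right.
\<close>

lemma left_canonical_bij: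
  assumes X: "X \<in> Ob C" and Y: "Y \<in> Ob C"
  shows "bij_betw (left_canonical_map K (vertex_hopf_algebra C X) (Alg C X Y) (Delta C X Y X))
    (carrier (tensor K (Alg C X Y) (Alg C X Y))) (carrier (tensor K (Alg C X X) (Alg C X Y)))"
proof -
  let ?A = "Alg C X Y" and ?H = "Alg C X X" and ?S = "Ant C Y X"
  let ?AA = "tensor K ?A ?A" and ?HA = "tensor K ?H ?A"
  let ?can = "left_canonical_map K (vertex_hopf_algebra C X) ?A (Delta C X Y X)"
  interpret A: k_algebra K ?A by (rule Alg_algebra[OF X Y])
  note H = Alg_module[OF X X] and A = Alg_module[OF X Y] and B = Alg_module[OF Y X]
  note AA = tensor_module[OF A A] and HA = tensor_module[OF H A]
  note S = linear_maps_closed[OF Ant_linear[OF Y X]]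
  note pAA = pure_tensor_bilinear[OF A A] and pHA = pure_tensor_bilinear[OF H A]
  note mult = mult_bilinear[OF A.k_algebra_axioms]
  note D = Delta_linear[OF X X Y] and \<alpha> = Delta_linear[OF X Y X]
  note vertex = k_algebra.axioms(3)[OF k_algebra_vertex[OF Alg_algebra[OF X X]]]
  note can_lin = left_canonical_map_linear[OF A.k_algebra_axioms vertex, unfolded tensor_vertex, OF \<alpha>]
  note can_pure = left_canonical_map_pure[OF A.k_algebra_axioms vertex, unfolded tensor_vertex, OF \<alpha>]
  note inv_tri = nested_bilinear_trilinear[OF pAA mult_Ant_bilinear(2)[OF X Y]]
  note inv_bil = tensor_lift_Delta_nested_bilinear(1)[OF X Y X Y AA inv_tri]
  have inv_lin: "left_canonical_inverse X Y \<in> linear_maps K ?HA ?AA"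
    unfolding left_canonical_inverse_def by (rule tensor_lift_linear[OF H A AA inv_bil])
  have inv_pure: "left_canonical_inverse X Y (pure_tensor K ?H ?A h y)
      = tensor_lift K ?AA (\<lambda>a b. pure_tensor K ?A ?A a (?S b \<otimes>\<^bsub>?A\<^esub> y)) (Delta C X X Y h)"
    if "h \<in> carrier ?H" "y \<in> carrier ?A" for h y
    unfolding left_canonical_inverse_def by (rule tensor_lift_pure[OF H A AA inv_bil that])
  show ?thesis
  proof (rule tensor_bij_betwI[OF A A H A can_lin inv_lin])
    fix x y assume x: "x \<in> carrier ?A" and y: "y \<in> carrier ?A"
    have G: "(\<lambda>b u. pure_tensor K ?A ?A b (u \<otimes>\<^bsub>?A\<^esub> y)) \<in> bilinear_maps K ?A ?A ?AA"
      by (rule bilinear_map_compose[OF pAA linear_map_id bilinear_maps_left[OF mult y]])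
    have Ghp: "(\<lambda>h a. pure_tensor K ?H ?A h (a \<otimes>\<^bsub>?A\<^esub> y)) \<in> bilinear_maps K ?H ?A ?HA"
      by (rule bilinear_map_compose[OF pHA linear_map_id bilinear_maps_left[OF mult y]])
    have "left_canonical_inverse X Y (?can (pure_tensor K ?A ?A x y))
        = tensor_lift K ?AA (\<lambda>h a. left_canonical_inverse X Y (pure_tensor K ?H ?A h (a \<otimes>\<^bsub>?A\<^esub> y))) (Delta C X Y X x)"
      unfolding can_pure[OF x y]
      by (rule linear_tensor_lift[OF H A HA AA Ghp inv_lin linear_maps_closed[OF \<alpha> x]])
    also have "\<dots> = tensor_lift K ?AA (\<lambda>h a. tensor_lift K ?AA (\<lambda>b c.
        pure_tensor K ?A ?A b ((?S c \<otimes>\<^bsub>?A\<^esub> a) \<otimes>\<^bsub>?A\<^esub> y)) (Delta C X X Y h)) (Delta C X Y X x)"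
    proof (rule tensor_lift_cong[OF H A AA linear_bilinear_compose[OF inv_lin Ghp]
          linear_maps_closed[OF \<alpha> x]])
      fix h a assume h: "h \<in> carrier ?H" and a: "a \<in> carrier ?A"
      have ay: "a \<otimes>\<^bsub>?A\<^esub> y \<in> carrier ?A" using a y by simp
      show "left_canonical_inverse X Y (pure_tensor K ?H ?A h (a \<otimes>\<^bsub>?A\<^esub> y))
          = tensor_lift K ?AA (\<lambda>b c. pure_tensor K ?A ?A b ((?S c \<otimes>\<^bsub>?A\<^esub> a) \<otimes>\<^bsub>?A\<^esub> y)) (Delta C X X Y h)"
        unfolding inv_pure[OF h ay]
        by (rule tensor_lift_cong[OF A B AA trilinear_mapsD(2)[OF inv_tri ay] linear_maps_closed[OF D h]])
          (simp add: A.m_assoc S a y)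
    qed
    also have "\<dots> = pure_tensor K ?A ?A x (\<one>\<^bsub>?A\<^esub> \<otimes>\<^bsub>?A\<^esub> y)"
      by (rule cancel_Ant_left_second[OF X Y AA G x])
    finally show "left_canonical_inverse X Y (?can (pure_tensor K ?A ?A x y)) = pure_tensor K ?A ?A x y"
      using y by simp
  next
    fix h y assume h: "h \<in> carrier ?H" and y: "y \<in> carrier ?A"
    have G: "(\<lambda>h u. pure_tensor K ?H ?A h (u \<otimes>\<^bsub>?A\<^esub> y)) \<in> bilinear_maps K ?H ?A ?HA"
      by (rule bilinear_map_compose[OF pHA linear_map_id bilinear_maps_left[OF mult y]])
    note P = trilinear_mapsD(2)[OF inv_tri y]
    have "?can (left_canonical_inverse X Y (pure_tensor K ?H ?A h y))
        = tensor_lift K ?HA (\<lambda>a b. ?can (pure_tensor K ?A ?A a (?S b \<otimes>\<^bsub>?A\<^esub> y))) (Delta C X X Y h)"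
      unfolding inv_pure[OF h y]
      by (rule linear_tensor_lift[OF A B AA HA P can_lin linear_maps_closed[OF D h]])
    also have "\<dots> = tensor_lift K ?HA (\<lambda>a b. tensor_lift K ?HA (\<lambda>h a.
        pure_tensor K ?H ?A h ((a \<otimes>\<^bsub>?A\<^esub> ?S b) \<otimes>\<^bsub>?A\<^esub> y)) (Delta C X Y X a)) (Delta C X X Y h)"
    proof (rule tensor_lift_cong[OF A B HA linear_bilinear_compose[OF can_lin P]
          linear_maps_closed[OF D h]])
      fix a b assume a: "a \<in> carrier ?A" and b: "b \<in> carrier (Alg C Y X)"
      have Sby: "?S b \<otimes>\<^bsub>?A\<^esub> y \<in> carrier ?A" using S b y by simp
      have Q: "(\<lambda>h a. pure_tensor K ?H ?A h (a \<otimes>\<^bsub>?A\<^esub> (?S b \<otimes>\<^bsub>?A\<^esub> y))) \<in> bilinear_maps K ?H ?A ?HA"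
        by (rule bilinear_map_compose[OF pHA linear_map_id bilinear_maps_left[OF mult Sby]])
      show "?can (pure_tensor K ?A ?A a (?S b \<otimes>\<^bsub>?A\<^esub> y))
          = tensor_lift K ?HA (\<lambda>h a. pure_tensor K ?H ?A h ((a \<otimes>\<^bsub>?A\<^esub> ?S b) \<otimes>\<^bsub>?A\<^esub> y)) (Delta C X Y X a)"
        unfolding can_pure[OF a Sby]
        by (rule tensor_lift_cong[OF H A HA Q linear_maps_closed[OF \<alpha> a]])
          (simp add: A.m_assoc S b y)
    qed
    also have "\<dots> = pure_tensor K ?H ?A h (\<one>\<^bsub>?A\<^esub> \<otimes>\<^bsub>?A\<^esub> y)"
      by (rule cancel_Ant_right_second[OF X Y HA G h])
    finally show "?can (left_canonical_inverse X Y (pure_tensor K ?H ?A h y)) = pure_tensor K ?H ?A h y"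
      using y by simp
  qed
qed

text \<open>
  The mirror argument, with \<open>G(u, a) = x u \<otimes> a\<close>: the factor \<open>x\<close> is carried along on
  the left.
\<close>

lemma right_canonical_bij:
  assumes X: "X \<in> Ob C" and Y: "Y \<in> Ob C"
  shows "bij_betw (right_canonical_map K (vertex_hopf_algebra C Y) (Alg C X Y) (Delta C X Y Y))
    (carrier (tensor K (Alg C X Y) (Alg C X Y))) (carrier (tensor K (Alg C X Y) (Alg C Y Y)))"
proof -
  let ?A = "Alg C X Y" and ?L = "Alg C Y Y" and ?S = "Ant C Y X"
  let ?AA = "tensor K ?A ?A" and ?AL = "tensor K ?A ?L"
  let ?can = "right_canonical_map K (vertex_hopf_algebra C Y) ?A (Delta C X Y Y)"
  interpret A: k_algebra K ?A by (rule Alg_algebra[OF X Y])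
  note L = Alg_module[OF Y Y] and A = Alg_module[OF X Y] and B = Alg_module[OF Y X]
  note AA = tensor_module[OF A A] and AL = tensor_module[OF A L]
  note S = linear_maps_closed[OF Ant_linear[OF Y X]]
  note pAA = pure_tensor_bilinear[OF A A] and pAL = pure_tensor_bilinear[OF A L]
  note mult = mult_bilinear[OF A.k_algebra_axioms]
  note D = Delta_linear[OF Y Y X] and \<beta> = Delta_linear[OF X Y Y]
  note vertex = k_algebra.axioms(3)[OF k_algebra_vertex[OF Alg_algebra[OF Y Y]]]
  note can_lin = right_canonical_map_linear[OF A.k_algebra_axioms vertex, unfolded tensor_vertex, OF \<beta>]
  note can_pure = right_canonical_map_pure[OF A.k_algebra_axioms vertex, unfolded tensor_vertex, OF \<beta>]
  note inv_tri = nested_bilinear_trilinear'[OF pAA mult_Ant_bilinear(1)[OF X Y]]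
  note inv_bil = tensor_lift_Delta_nested_bilinear(2)[OF X Y X Y AA inv_tri]
  have inv_lin: "right_canonical_inverse X Y \<in> linear_maps K ?AL ?AA"
    unfolding right_canonical_inverse_def by (rule tensor_lift_linear[OF A L AA inv_bil])
  have inv_pure: "right_canonical_inverse X Y (pure_tensor K ?A ?L x l)
      = tensor_lift K ?AA (\<lambda>b a. pure_tensor K ?A ?A (x \<otimes>\<^bsub>?A\<^esub> ?S b) a) (Delta C Y Y X l)"
    if "x \<in> carrier ?A" "l \<in> carrier ?L" for x l
    unfolding right_canonical_inverse_def by (rule tensor_lift_pure[OF A L AA inv_bil that])
  show ?thesis
  proof (rule tensor_bij_betwI[OF A A A L can_lin inv_lin])
    fix x y assume x: "x \<in> carrier ?A" and y: "y \<in> carrier ?A"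
    have G: "(\<lambda>u a. pure_tensor K ?A ?A (x \<otimes>\<^bsub>?A\<^esub> u) a) \<in> bilinear_maps K ?A ?A ?AA"
      by (rule bilinear_map_compose[OF pAA bilinear_maps_right[OF mult x] linear_map_id])
    have Gpl: "(\<lambda>a l. pure_tensor K ?A ?L (x \<otimes>\<^bsub>?A\<^esub> a) l) \<in> bilinear_maps K ?A ?L ?AL"
      by (rule bilinear_map_compose[OF pAL bilinear_maps_right[OF mult x] linear_map_id])
    have "right_canonical_inverse X Y (?can (pure_tensor K ?A ?A x y))
        = tensor_lift K ?AA (\<lambda>a l. right_canonical_inverse X Y (pure_tensor K ?A ?L (x \<otimes>\<^bsub>?A\<^esub> a) l)) (Delta C X Y Y y)"
      unfolding can_pure[OF x y]
      by (rule linear_tensor_lift[OF A L AL AA Gpl inv_lin linear_maps_closed[OF \<beta> y]])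
    also have "\<dots> = tensor_lift K ?AA (\<lambda>a l. tensor_lift K ?AA (\<lambda>b c.
        pure_tensor K ?A ?A (x \<otimes>\<^bsub>?A\<^esub> (a \<otimes>\<^bsub>?A\<^esub> ?S b)) c) (Delta C Y Y X l)) (Delta C X Y Y y)"
    proof (rule tensor_lift_cong[OF A L AA linear_bilinear_compose[OF inv_lin Gpl]
          linear_maps_closed[OF \<beta> y]])
      fix a l assume a: "a \<in> carrier ?A" and l: "l \<in> carrier ?L"
      have xa: "x \<otimes>\<^bsub>?A\<^esub> a \<in> carrier ?A" using a x by simp
      show "right_canonical_inverse X Y (pure_tensor K ?A ?L (x \<otimes>\<^bsub>?A\<^esub> a) l)
          = tensor_lift K ?AA (\<lambda>b c. pure_tensor K ?A ?A (x \<otimes>\<^bsub>?A\<^esub> (a \<otimes>\<^bsub>?A\<^esub> ?S b)) c) (Delta C Y Y X l)"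
        unfolding inv_pure[OF xa l]
        by (rule tensor_lift_cong[OF B A AA trilinear_mapsD(1)[OF inv_tri xa] linear_maps_closed[OF D l]])
          (simp add: A.m_assoc S a x)
    qed
    also have "\<dots> = pure_tensor K ?A ?A (x \<otimes>\<^bsub>?A\<^esub> \<one>\<^bsub>?A\<^esub>) y"
      by (rule cancel_Ant_right_first[OF X Y AA G y])
    finally show "right_canonical_inverse X Y (?can (pure_tensor K ?A ?A x y)) = pure_tensor K ?A ?A x y"
      using x by simp
  next
    fix x l assume x: "x \<in> carrier ?A" and l: "l \<in> carrier ?L"
    have G: "(\<lambda>u l. pure_tensor K ?A ?L (x \<otimes>\<^bsub>?A\<^esub> u) l) \<in> bilinear_maps K ?A ?L ?AL"
      by (rule bilinear_map_compose[OF pAL bilinear_maps_right[OF mult x] linear_map_id])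
    note P = trilinear_mapsD(1)[OF inv_tri x]
    have "?can (right_canonical_inverse X Y (pure_tensor K ?A ?L x l))
        = tensor_lift K ?AL (\<lambda>b a. ?can (pure_tensor K ?A ?A (x \<otimes>\<^bsub>?A\<^esub> ?S b) a)) (Delta C Y Y X l)"
      unfolding inv_pure[OF x l]
      by (rule linear_tensor_lift[OF B A AA AL P can_lin linear_maps_closed[OF D l]])
    also have "\<dots> = tensor_lift K ?AL (\<lambda>b a. tensor_lift K ?AL (\<lambda>a l.
        pure_tensor K ?A ?L (x \<otimes>\<^bsub>?A\<^esub> (?S b \<otimes>\<^bsub>?A\<^esub> a)) l) (Delta C X Y Y a)) (Delta C Y Y X l)"
    proof (rule tensor_lift_cong[OF B A AL linear_bilinear_compose[OF can_lin P]
          linear_maps_closed[OF D l]])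
      fix b a assume a: "a \<in> carrier ?A" and b: "b \<in> carrier (Alg C Y X)"
      have xb: "x \<otimes>\<^bsub>?A\<^esub> ?S b \<in> carrier ?A" using S b x by simp
      have Q: "(\<lambda>a l. pure_tensor K ?A ?L ((x \<otimes>\<^bsub>?A\<^esub> ?S b) \<otimes>\<^bsub>?A\<^esub> a) l) \<in> bilinear_maps K ?A ?L ?AL"
        by (rule bilinear_map_compose[OF pAL bilinear_maps_right[OF mult xb] linear_map_id])
      show "?can (pure_tensor K ?A ?A (x \<otimes>\<^bsub>?A\<^esub> ?S b) a)
          = tensor_lift K ?AL (\<lambda>a l. pure_tensor K ?A ?L (x \<otimes>\<^bsub>?A\<^esub> (?S b \<otimes>\<^bsub>?A\<^esub> a)) l) (Delta C X Y Y a)"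
        unfolding can_pure[OF xb a]
        by (rule tensor_lift_cong[OF A L AL Q linear_maps_closed[OF \<beta> a]])
          (simp add: A.m_assoc S b x)
    qed
    also have "\<dots> = pure_tensor K ?A ?L (x \<otimes>\<^bsub>?A\<^esub> \<one>\<^bsub>?A\<^esub>) l"
      by (rule cancel_Ant_left_first[OF X Y AL G l])
    finally show "?can (right_canonical_inverse X Y (pure_tensor K ?A ?L x l)) = pure_tensor K ?A ?L x l"
      using x by simp
  qed
qed

end

section \<open>Bi-Galois objects\<close>

theorem proposition2p8:
  fixes K :: "('k, 'm) ring_scheme"
    and C :: "('o, 'k, 'a, 'z) cogroupoid_scheme"
    and X Y :: 'o
  assumes "connected_cogroupoid K C"
    and "X \<in> Ob C" and "Y \<in> Ob C"
  shows "bi_galois_object K (vertex_hopf_algebra C X) (vertex_hopf_algebra C Y)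
           (Alg C X Y) (Delta C X Y X) (Delta C X Y Y)"
proof -
  interpret connected_cogroupoid K C by fact
  note X = assms(2) and Y = assms(3)
  let ?H = "vertex_hopf_algebra C X" and ?L = "vertex_hopf_algebra C Y" and ?A = "Alg C X Y"
  have left: "left_comodule_algebra K ?H ?A (Delta C X Y X)"
    using hopf_algebra_vertex[OF X] Alg_algebra[OF X Y] Delta_algebra_map[OF X Y X]
      coassociative[OF X Y X X] counit_left[OF X Y]
    by (intro left_comodule_algebra.intro) simp_all
  have right: "right_comodule_algebra K ?L ?A (Delta C X Y Y)"
    using hopf_algebra_vertex[OF Y] Alg_algebra[OF X Y] Delta_algebra_map[OF X Y Y]
      coassociative[OF X Y Y Y] counit_right[OF X Y]
    by (intro right_comodule_algebra.intro) simp_all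
  \<comment> \<open>Compatibility of the two coactions is coassociativity with \<open>Z = Y\<close> and \<open>T = X\<close>.\<close>
  have bi: "bicomodule_algebra K ?H ?L ?A (Delta C X Y X) (Delta C X Y Y)"
    using left right coassociative[OF X Y Y X]
    by (intro bicomodule_algebra.intro bicomodule_algebra_axioms.intro) simp_all
  have "left_galois_object K ?H ?A (Delta C X Y X)"
    using left connected[OF X Y] left_canonical_bij[OF X Y]
    by (intro left_galois_object.intro left_galois_object_axioms.intro)
      (simp_all del: tensor_sel)
  moreover have "right_galois_object K ?L ?A (Delta C X Y Y)"
    using right connected[OF X Y] right_canonical_bij[OF X Y]
    by (intro right_galois_object.intro right_galois_object_axioms.intro)
      (simp_all del: tensor_sel)
  ultimately show ?thesis using bi by (intro bi_galois_object.intro)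
qed

end
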